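(* Let $H$ be a nonzero complex Hilbert space. A connection $\sigma$ on $B(H)^{+}$ with representing function $f$ (i.e., $\sigma=\sigma_f$) is the geometric mean $\#$ if and only if all of the following statements hold: (i) $f\in OM_+$; (ii) $f(1)=1$; (iii) $xf(1/x)=f(x)$ for $x>0$; (iv) there exist two logarithmically incommensurate positive scalars $c_1\ne1$, $c_2\ne1$ (i.e., $\frac{\log c_1}{\log c_2}\notin\mathbb{Q}$) such that $f(c_1^{2}x)=c_1f(x)$ and $f(c_2^{2}x)=c_2f(x)$ for $x>0$.
   Context: $B(H)^{+}$ is the set of positive semidefinite bounded linear operators on $H$, ordered by the Loewner order; $B(H)^{++}$ is the set of invertible elements of $B(H)^{+}$; $I$ is the identity. $A_n\downarrow A$ means $A_1\ge A_2\ge\cdots$ and $A_n\to A$ strongly. A connection is a binary operation $\sigma$ on $B(H)^{+}$ such that: (I) $A\le C$, $B\le D$ imply $A\sigma B\le C\sigma D$; (II) $C(A\sigma B)C\le (CAC)\sigma(CBC)$; (III) $A_n\downarrow A$, $B_n\downarrow B$ imply $A_n\sigma B_n\downarrow A\sigma B$. $OM_+$ denotes the class of all analytic functions $f:\mathbb{C}\setminus(-\infty,0]\to\mathbb{C}$ with $f(x)\ge 0$ for real $x>0$ and $\operatorname{Im} f(z)\ge 0$ whenever $\operatorname{Im} z>0$; by Loewner's theorem, restriction to $(0,\infty)$ identifies $OM_+$ with the positive operator monotone functions $(0,\infty)\to[0,\infty)$, and the two are not distinguished. A positive operator monotone function $f$ gives rise to a connection $\sigma_f$ by $A\sigma_f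 B=A^{1/2}f(A^{-1/2}BA^{-1/2})A^{1/2}$ for $A,B\in B(H)^{++}$, extended uniquely to $B(H)^{+}$ by (III); $f$ is called the representing function of $\sigma=\sigma_f$, and it is recovered by $f(x)I=I\sigma(xI)$, $x>0$. The geometric mean $\#$ is the connection given by $A\#B=A^{1/2}(A^{-1/2}BA^{-1/2})^{1/2}A^{1/2}$ for $A,B\in B(H)^{++}$, extended to $B(H)^{+}$ by (III); its representing function is $\sqrt{x}$. *)

theory Defs
  imports "HOL-Complex_Analysis.Complex_Analysis" "HOL-Computational_Algebra.Polynomial"
begin

text \<open>
  A complex Hilbert space, presented on top of the library's real inner product spaces: the real
  structure is the restriction of the complex one, so norm, topology and completeness are those
  of the complex inner product. The inner product is linear in its first argument; its definiteness
  is inherited from \<^class>\<open>real_inner\<close> through \<open>inner_eq_Re_cinner\<close>.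
\<close>

class complex_hilbert_space = real_inner + banach +
  fixes scaleC :: "complex \<Rightarrow> 'a \<Rightarrow> 'a" (infixr "*\<^sub>C" 75)
    and cinner :: "'a \<Rightarrow> 'a \<Rightarrow> complex"
  assumes scaleC_add_right: "a *\<^sub>C (x + y) = a *\<^sub>C x + a *\<^sub>C y"
    and scaleC_add_left: "(a + b) *\<^sub>C x = a *\<^sub>C x + b *\<^sub>C x"
    and scaleC_scaleC: "a *\<^sub>C b *\<^sub>C x = (a * b) *\<^sub>C x"
    and scaleR_scaleC: "r *\<^sub>R x = complex_of_real r *\<^sub>C x"
    and cinner_commute: "cinner x y = cnj (cinner y x)"
    and cinner_add_left: "cinner (x + y) z = cinner x z + cinner y z"
    and cinner_scaleC_left: "cinner (a *\<^sub>C x) y = a * cinner x y"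
    and inner_eq_Re_cinner: "inner x y = Re (cinner x y)"

instantiation complex :: complex_hilbert_space
begin

definition scaleC_complex :: "complex \<Rightarrow> complex \<Rightarrow> complex"
  where "scaleC_complex a z = a * z"

definition cinner_complex :: "complex \<Rightarrow> complex \<Rightarrow> complex"
  where "cinner_complex z w = z * cnj w"

instance
  by standard (auto simp: scaleC_complex_def cinner_complex_def inner_complex_def
      algebra_simps scaleR_conv_of_real)

end

text \<open>
  Operators are elements of the type of bounded real-linear maps; \<open>B(H)\<close> is the set of those that
  are complex-linear.
\<close>

type_synonym 'a op = "'a \<Rightarrow>\<^sub>L 'a"

definition BH :: "'a::complex_hilbert_space op set"
  where "BH = {A. \<forall>c x. blinfun_apply A (c *\<^sub>C x) = c *\<^sub>C blinfun_apply A x}"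

definition BH_pos :: "'a::complex_hilbert_space op set"
  where "BH_pos = {A \<in> BH. \<forall>x. cinner (blinfun_apply A x) x \<in> \<real>\<^sub>\<ge>\<^sub>0}"

definition loewner_le :: "'a::complex_hilbert_space op \<Rightarrow> 'a op \<Rightarrow> bool" (infix "\<preceq>" 50)
  where "A \<preceq> B \<longleftrightarrow> B - A \<in> BH_pos"

definition op_invertible :: "'a::complex_hilbert_space op \<Rightarrow> bool"
  where "op_invertible A \<longleftrightarrow> (\<exists>B\<in>BH. A o\<^sub>L B = id_blinfun \<and> B o\<^sub>L A = id_blinfun)"

definition op_inv :: "'a::complex_hilbert_space op \<Rightarrow> 'a op"
  where "op_inv A = (THE B. B \<in> BH \<and> A o\<^sub>L B = id_blinfun \<and> B o\<^sub>L A = id_blinfun)"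

definition BH_pd :: "'a::complex_hilbert_space op set"
  where "BH_pd = {A \<in> BH_pos. op_invertible A}"

definition op_sqrt :: "'a::complex_hilbert_space op \<Rightarrow> 'a op"
  where "op_sqrt A = (THE S. S \<in> BH_pos \<and> S o\<^sub>L S = A)"

definition strong_lim :: "(nat \<Rightarrow> 'a::complex_hilbert_space op) \<Rightarrow> 'a op \<Rightarrow> bool"
  where "strong_lim X A \<longleftrightarrow> (\<forall>x. (\<lambda>n. blinfun_apply (X n) x) \<longlonglongrightarrow> blinfun_apply A x)"

definition op_decseq_to :: "(nat \<Rightarrow> 'a::complex_hilbert_space op) \<Rightarrow> 'a op \<Rightarrow> bool"
    (infix "\<down>" 50)
  where "X \<down> A \<longleftrightarrow> (\<forall>n. X (Suc n) \<preceq> X n) \<and> strong_lim X A"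

definition is_connection :: "('a::complex_hilbert_space op \<Rightarrow> 'a op \<Rightarrow> 'a op) \<Rightarrow> bool"
  where "is_connection \<sigma> \<longleftrightarrow>
    (\<forall>A\<in>BH_pos. \<forall>B\<in>BH_pos. \<sigma> A B \<in> BH_pos) \<and>
    (\<forall>A\<in>BH_pos. \<forall>B\<in>BH_pos. \<forall>C\<in>BH_pos. \<forall>D\<in>BH_pos.
       A \<preceq> C \<longrightarrow> B \<preceq> D \<longrightarrow> \<sigma> A B \<preceq> \<sigma> C D) \<and>
    (\<forall>A\<in>BH_pos. \<forall>B\<in>BH_pos. \<forall>C\<in>BH_pos.
       C o\<^sub>L \<sigma> A B o\<^sub>L C \<preceq> \<sigma> (C o\<^sub>L A o\<^sub>L C) (C o\<^sub>L B o\<^sub>L C)) \<and>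
    (\<forall>X Y. \<forall>A\<in>BH_pos. \<forall>B\<in>BH_pos. range X \<subseteq> BH_pos \<longrightarrow> range Y \<subseteq> BH_pos \<longrightarrow>
       X \<down> A \<longrightarrow> Y \<down> B \<longrightarrow> (\<lambda>n. \<sigma> (X n) (Y n)) \<down> \<sigma> A B)"

text \<open>
  Continuous functional calculus for self-adjoint operators. The spectrum of a self-adjoint operator
  is real, so it is enough to record its real points. \<open>f(A)\<close> is the common norm limit of \<open>p\<^sub>n(A)\<close>
  over all sequences of real polynomials converging to \<open>f\<close> uniformly on the spectrum.
\<close>

definition real_spectrum :: "'a::complex_hilbert_space op \<Rightarrow> real set"
  where "real_spectrum A = {t. \<not> op_invertible (A - t *\<^sub>R id_blinfun)}"

definition op_poly :: "real poly \<Rightarrow> 'a::complex_hilbert_space op \<Rightarrow> 'a op"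
  where "op_poly p A = (\<Sum>i\<le>degree p. coeff p i *\<^sub>R ((\<lambda>B. A o\<^sub>L B) ^^ i) id_blinfun)"

definition fun_calc :: "(real \<Rightarrow> real) \<Rightarrow> 'a::complex_hilbert_space op \<Rightarrow> 'a op"
  where "fun_calc f A = (THE T. \<forall>p :: nat \<Rightarrow> real poly.
    uniform_limit (real_spectrum A) (\<lambda>n. poly (p n)) f sequentially \<longrightarrow>
    (\<lambda>n. op_poly (p n) A) \<longlonglongrightarrow> T)"

text \<open>
  Extension to \<open>B(H)\<^sup>+\<close>, forced by monotone continuity, of an operation \<open>m\<close> given
  on positive invertible operators.
\<close>

definition extend_mono :: "('a::complex_hilbert_space op \<Rightarrow> 'a op \<Rightarrow> 'a op) \<Rightarrow> 'a op \<Rightarrow> 'a op \<Rightarrow> 'a op"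
  where "extend_mono m A B =
    (if A \<in> BH_pd \<and> B \<in> BH_pd then m A B
     else (THE T. \<forall>X Y. range X \<subseteq> BH_pd \<longrightarrow> range Y \<subseteq> BH_pd \<longrightarrow> X \<down> A \<longrightarrow> Y \<down> B \<longrightarrow>
             (\<lambda>n. m (X n) (Y n)) \<down> T))"

definition connection_of :: "(real \<Rightarrow> real) \<Rightarrow> 'a::complex_hilbert_space op \<Rightarrow> 'a op \<Rightarrow> 'a op"
  where "connection_of f = extend_mono (\<lambda>A B.
    op_sqrt A o\<^sub>L fun_calc f (op_inv (op_sqrt A) o\<^sub>L B o\<^sub>L op_inv (op_sqrt A)) o\<^sub>L op_sqrt A)"

definition geometric_mean :: "'a::complex_hilbert_space op \<Rightarrow> 'a op \<Rightarrow> 'a op"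
  where "geometric_mean = extend_mono (\<lambda>A B.
    op_sqrt A o\<^sub>L op_sqrt (op_inv (op_sqrt A) o\<^sub>L B o\<^sub>L op_inv (op_sqrt A)) o\<^sub>L op_sqrt A)"

text \<open>
  Operations on \<open>B(H)\<^sup>+\<close> are total functions on operators; only their values on \<open>B(H)\<^sup>+\<close> matter.
\<close>

definition eq_on_pos ::
    "('a::complex_hilbert_space op \<Rightarrow> 'a op \<Rightarrow> 'a op) \<Rightarrow> ('a op \<Rightarrow> 'a op \<Rightarrow> 'a op) \<Rightarrow> bool"
  where "eq_on_pos \<sigma> \<tau> \<longleftrightarrow> (\<forall>A\<in>BH_pos. \<forall>B\<in>BH_pos. \<sigma> A B = \<tau> A B)"

definition OM_plus :: "(complex \<Rightarrow> complex) set"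
  where "OM_plus = {F. F analytic_on (- \<real>\<^sub>\<le>\<^sub>0) \<and>
    (\<forall>x::real. x > 0 \<longrightarrow> F (of_real x) \<in> \<real>\<^sub>\<ge>\<^sub>0) \<and>
    (\<forall>z. Im z > 0 \<longrightarrow> Im (F z) \<ge> 0)}"

text \<open>
  Membership in \<open>OM\<^sub>+\<close> for a function given on \<open>(0,\<infinity>)\<close>, under the identification of an element
  of \<open>OM\<^sub>+\<close> with its restriction.
\<close>

definition in_OM_plus :: "(real \<Rightarrow> real) \<Rightarrow> bool"
  where "in_OM_plus f \<longleftrightarrow> (\<exists>F\<in>OM_plus. \<forall>x>0. F (of_real x) = of_real (f x))"

end

theory Submission
  imports Defs "HOL-Computational_Algebra.Fundamental_Theorem_Algebra"
begin

text \<open>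
  On \<open>(0,\<infinity>)\<close> the four conditions are equivalent to \<open>f = sqrt\<close>: by (iv), \<open>s \<mapsto> f (exp s) / exp (s/2)\<close>
  has the incommensurable periods \<open>2 ln c\<^sub>1\<close> and \<open>2 ln c\<^sub>2\<close>, so being continuous it is constant, equal
  to \<open>f 1 = 1\<close>. It remains that the functional calculus of \<open>sqrt\<close> on a positive invertible operator
  \<open>C\<close> is its positive square root \<open>S\<close>. For a real polynomial \<open>p\<close>, \<open>p(C) - S = q(S)\<close> with
  \<open>q(t) = p(t\<^sup>2) - t\<close>, and \<open>\<parallel>q(S)\<parallel>\<close> is at most the supremum of \<open>\<bar>q\<bar>\<close> on the spectrum of \<open>S\<close>, because
  one of \<open>\<parallel>T\<parallel>\<close>, \<open>-\<parallel>T\<parallel>\<close> is in the spectrum of a self-adjoint \<open>T\<close> and real spectral values of \<open>q(S)\<close> come from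
  those of \<open>S\<close>. Conversely, \<open>f\<close> is read off from the values of the connection at \<open>(I, xI)\<close>.
\<close>

section \<open>Self-adjoint operators and invertibility\<close>

text \<open>Symmetry for the real inner product suffices: for a complex-linear map it implies
  symmetry for \<open>cinner\<close>, because \<open>Im (cinner x y)\<close> is minus the real inner
  product of \<open>\<i> *\<^sub>C x\<close> with \<open>y\<close>.\<close>

definition BH_sa :: "'a::complex_hilbert_space op set"
  where "BH_sa = {A \<in> BH. \<forall>x y. A x \<bullet> y = x \<bullet> A y}"

lemma scaleC_scaleR_commute: "c *\<^sub>C r *\<^sub>R x = r *\<^sub>R c *\<^sub>C (x::'a::complex_hilbert_space)"
  by (simp add: scaleR_scaleC scaleC_scaleC mult.commute)

lemma scaleC_diff_right: "c *\<^sub>C (x - y) = c *\<^sub>C x - c *\<^sub>C (y::'a::complex_hilbert_space)"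
  using scaleC_add_right[of c "x - y" y] by (simp add: algebra_simps)

lemma BH_D: "A \<in> BH \<Longrightarrow> A (c *\<^sub>C x) = c *\<^sub>C A x"
  by (simp add: BH_def)

lemma BH_add [intro]: "A \<in> BH \<Longrightarrow> B \<in> BH \<Longrightarrow> A + B \<in> BH"
  by (simp add: BH_def blinfun.bilinear_simps scaleC_add_right)

lemma BH_diff [intro]: "A \<in> BH \<Longrightarrow> B \<in> BH \<Longrightarrow> A - B \<in> BH"
  by (simp add: BH_def blinfun.bilinear_simps scaleC_diff_right)

lemma BH_scaleR [intro]: "A \<in> BH \<Longrightarrow> r *\<^sub>R A \<in> BH"
  by (simp add: BH_def blinfun.bilinear_simps scaleC_scaleR_commute)

lemma BH_id [intro]: "id_blinfun \<in> BH"
  by (simp add: BH_def)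

lemma BH_compose [intro]: "A \<in> BH \<Longrightarrow> B \<in> BH \<Longrightarrow> A o\<^sub>L B \<in> BH"
  by (simp add: BH_def)

lemma BH_sa_D: "A \<in> BH_sa \<Longrightarrow> A \<in> BH" "A \<in> BH_sa \<Longrightarrow> A x \<bullet> y = x \<bullet> A y"
  by (auto simp: BH_sa_def)

lemma BH_sa_add [intro]: "A \<in> BH_sa \<Longrightarrow> B \<in> BH_sa \<Longrightarrow> A + B \<in> BH_sa"
  by (auto simp: BH_sa_def blinfun.bilinear_simps inner_simps)

lemma BH_sa_diff [intro]: "A \<in> BH_sa \<Longrightarrow> B \<in> BH_sa \<Longrightarrow> A - B \<in> BH_sa"
  by (auto simp: BH_sa_def blinfun.bilinear_simps inner_simps)

lemma BH_sa_scaleR [intro]: "A \<in> BH_sa \<Longrightarrow> r *\<^sub>R A \<in> BH_sa"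
  by (auto simp: BH_sa_def blinfun.bilinear_simps inner_simps)

lemma BH_sa_id [intro]: "id_blinfun \<in> BH_sa"
  by (auto simp: BH_sa_def)

lemma BH_sa_commuting_compose: 
  assumes "A \<in> BH_sa" "B \<in> BH_sa" "A o\<^sub>L B = B o\<^sub>L A"
  shows "A o\<^sub>L B \<in> BH_sa"
proof -
  have "A (B x) \<bullet> y = x \<bullet> A (B y)" for x y
    using assms by (metis BH_sa_D(2) blinfun_apply_blinfun_compose)
  then show ?thesis using assms by (auto simp: BH_sa_def)
qed

section \<open>The complex inner product in terms of the real one; positivity\<close>

lemma cinner_scaleC_right: "cinner x (c *\<^sub>C y) = cnj c * cinner x (y::'a::complex_hilbert_space)"
  by (metis cinner_commute cinner_scaleC_left complex_cnj_cnj complex_cnj_mult)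

lemma Im_cinner: "Im (cinner x y) = - ((\<i> *\<^sub>C x) \<bullet> (y::'a::complex_hilbert_space))"
  by (simp add: inner_eq_Re_cinner cinner_scaleC_left)

lemma scaleC_ii_inner: "(\<i> *\<^sub>C x) \<bullet> y = - (x \<bullet> (\<i> *\<^sub>C (y::'a::complex_hilbert_space)))"
  by (simp add: inner_eq_Re_cinner cinner_scaleC_left cinner_scaleC_right)

lemma scaleC_ii_ii: "\<i> *\<^sub>C \<i> *\<^sub>C x = - (x::'a::complex_hilbert_space)"
  using scaleR_scaleC[of "-1" x] by (simp add: scaleC_scaleC)

text \<open>A real-valued form \<open>cinner (A x) x\<close> makes
  \<open>(\<i> *\<^sub>C A x) \<bullet> x\<close> vanish identically. Polarizing this and replacing
  \<open>y\<close> by \<open>\<i> *\<^sub>C y\<close> gives symmetry; this is where the scalars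
  being complex matters.\<close>

lemma BH_pos_iff: "A \<in> BH_pos \<longleftrightarrow> A \<in> BH_sa \<and> (\<forall>x. 0 \<le> A x \<bullet> x)"
proof
  assume A: "A \<in> BH_pos"
  then have BH: "A \<in> BH" and pos: "0 \<le> A x \<bullet> x" and real: "(\<i> *\<^sub>C A x) \<bullet> x = 0" for x
    using Im_cinner[of "A x" x]
    by (auto simp: BH_pos_def complex_nonneg_Reals_iff inner_eq_Re_cinner[of "A x" x])
  have anti: "(\<i> *\<^sub>C A x) \<bullet> y + (\<i> *\<^sub>C A y) \<bullet> x = 0" for x y
    using real[of "x + y"] real[of x] real[of y]
    by (simp add: blinfun.bilinear_simps scaleC_add_right inner_simps)
  have "A x \<bullet> y = x \<bullet> A y" for x y
    using anti[of x "\<i> *\<^sub>C y"]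
    by (simp add: BH_D[OF BH] scaleC_ii_ii scaleC_ii_inner inner_commute)
  then show "A \<in> BH_sa \<and> (\<forall>x. 0 \<le> A x \<bullet> x)"
    using BH pos by (simp add: BH_sa_def)
next
  assume A: "A \<in> BH_sa \<and> (\<forall>x. 0 \<le> A x \<bullet> x)"
  then have BH: "A \<in> BH" and sym: "\<And>x y. A x \<bullet> y = x \<bullet> A y"
    by (auto simp: BH_sa_def)
  have "(\<i> *\<^sub>C A x) \<bullet> x = 0" for x
    using sym[of "\<i> *\<^sub>C x" x] scaleC_ii_inner[of x "A x"] inner_commute[of x "\<i> *\<^sub>C A x"]
    by (simp add: BH_D[OF BH])
  then show "A \<in> BH_pos"
    using A BH by (auto simp: BH_pos_def complex_nonneg_Reals_iff Im_cinner inner_eq_Re_cinner[symmetric])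
qed

section \<open>Invertibility, lower bounds and coercivity\<close>

lemma blinfun_compose_eq_idD: "A o\<^sub>L B = id_blinfun \<Longrightarrow> A (B x) = x"
  by (metis blinfun_apply_blinfun_compose blinfun_apply_id_blinfun)

lemma op_invertible_id: "op_invertible id_blinfun"
  unfolding op_invertible_def by (intro bexI[of _ id_blinfun]) (auto intro!: blinfun_eqI)

lemma op_invertible_scaleR:
  assumes "op_invertible A" "r \<noteq> 0"
  shows "op_invertible (r *\<^sub>R A)"
proof -
  obtain B where "B \<in> BH" "A o\<^sub>L B = id_blinfun" "B o\<^sub>L A = id_blinfun"
    using assms by (auto simp: op_invertible_def)
  then show ?thesis
    unfolding op_invertible_def using assms(2)
    by (intro bexI[of _ "inverse r *\<^sub>R B"])
      (auto simp: bounded_bilinear.scaleR_left[OF bounded_bilinear_blinfun_compose]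
        bounded_bilinear.scaleR_right[OF bounded_bilinear_blinfun_compose])
qed

lemma op_invertible_compose:
  assumes "op_invertible A" "op_invertible B"
  shows "op_invertible (A o\<^sub>L B)"
proof -
  obtain A' B' where inv: "A' \<in> BH" "A o\<^sub>L A' = id_blinfun" "A' o\<^sub>L A = id_blinfun"
    "B' \<in> BH" "B o\<^sub>L B' = id_blinfun" "B' o\<^sub>L B = id_blinfun"
    using assms by (auto simp: op_invertible_def)
  note this(2,3,5,6)[THEN blinfun_compose_eq_idD]
  with inv(1,4) show ?thesis
    unfolding op_invertible_def
    by (intro bexI[of _ "B' o\<^sub>L A'"]) (auto intro!: blinfun_eqI)
qed

text \<open>If \<open>C\<close> inverts the product, then \<open>B o\<^sub>L C\<close> is a right
  inverse of \<open>A\<close> and, by commutation, \<open>C o\<^sub>L B\<close> a left inverse, so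
  the two coincide.\<close>

lemma op_invertible_commuting_factor:
  assumes "A \<in> BH" "B \<in> BH" "A o\<^sub>L B = B o\<^sub>L A" "op_invertible (A o\<^sub>L B)"
  shows "op_invertible A"
proof -
  obtain C where C: "C \<in> BH" "A o\<^sub>L B o\<^sub>L C = id_blinfun" "C o\<^sub>L (A o\<^sub>L B) = id_blinfun"
    using assms by (auto simp: op_invertible_def)
  then have R: "A (B (C x)) = x" for x
    using blinfun_compose_eq_idD[of "A o\<^sub>L B" C] by simp
  have L: "C (B (A x)) = x" for x
    using C(3) assms(3) blinfun_compose_eq_idD[of C "B o\<^sub>L A"] by simp
  have "C (B x) = B (C x)" for x
    using L[of "B (C x)"] by (simp add: R)
  then show ?thesis
    unfolding op_invertible_def using C(1) assms(2) R L
    by (intro bexI[of _ "B o\<^sub>L C"]) (auto intro!: blinfun_eqI)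
qed

lemma op_invertible_bounded_below:
  assumes "op_invertible A"
  obtains c where "c > 0" "\<And>x. c * norm x \<le> norm (A x)"
proof -
  obtain B where B: "B o\<^sub>L A = id_blinfun"
    using assms by (auto simp: op_invertible_def)
  show ?thesis
  proof (rule that)
    \<comment> \<open>Adding 1 to \<open>norm B\<close> covers the case
      \<open>norm B = 0\<close>.\<close>
    show "inverse (norm B + 1) > 0"
      by (simp add: add_nonneg_pos)
    fix x
    have "norm x \<le> norm B * norm (A x)"
      by (metis B blinfun_apply_blinfun_compose blinfun_apply_id_blinfun norm_blinfun)
    also have "\<dots> \<le> (norm B + 1) * norm (A x)"
      by (simp add: mult_right_mono)
    finally show "inverse (norm B + 1) * norm x \<le> norm (A x)"
      by (simp add: field_simps add_pos_nonneg add_nonneg_pos)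
  qed
qed

text \<open>Expanding the square bounds the squared norm of \<open>x - e *\<^sub>R A x\<close> by
  \<open>(1 - 2 * e * c + e\<^sup>2 * N) * (x \<bullet> x)\<close>, and for small \<open>e\<close>
  the linear term wins. The contraction obtained serves both for inverting \<open>A\<close> and for
  extracting its square root.\<close>

lemma coercive_relaxation:
  fixes A :: "'a::complex_hilbert_space op"
  assumes "c > 0" and coercive: "\<And>x. c * (x \<bullet> x) \<le> A x \<bullet> x"
  obtains e where "e > 0" "norm (id_blinfun - e *\<^sub>R A) < 1"
proof -
  define N where "N = (norm A)\<^sup>2"
  \<comment> \<open>The factor is smallest at \<open>c / N\<close>; the denominator
    \<open>N + 1\<close> avoids a division by zero and still leaves at most
    \<open>1 - c\<^sup>2 / (N + 1)\<close>.\<close>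
  define e where "e = c / (N + 1)"
  define k where "k = sqrt (max 0 (1 - c\<^sup>2 / (N + 1)))"
  have N: "N \<ge> 0" by (simp add: N_def)
  have e: "e > 0" using N assms(1) by (simp add: e_def)
  have k: "0 \<le> k" "k < 1" using assms(1) N by (auto simp: k_def)
  have "norm ((id_blinfun - e *\<^sub>R A) x) \<le> k * norm x" for x
  proof (rule power2_le_imp_le)
    have "(norm ((id_blinfun - e *\<^sub>R A) x))\<^sup>2 = x \<bullet> x - 2 * e * (A x \<bullet> x) + e\<^sup>2 * (norm (A x))\<^sup>2"
      unfolding power2_norm_eq_inner
      by (simp add: blinfun.bilinear_simps inner_simps inner_commute power2_eq_square algebra_simps)
    also have "\<dots> \<le> x \<bullet> x - 2 * e * (c * (x \<bullet> x)) + e\<^sup>2 * (N * (x \<bullet> x))"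
    proof -
      have "(norm (A x))\<^sup>2 \<le> N * (x \<bullet> x)"
        unfolding N_def power2_norm_eq_inner[symmetric] power_mult_distrib[symmetric]
        by (intro power_mono norm_blinfun) auto
      then have "e\<^sup>2 * (norm (A x))\<^sup>2 \<le> e\<^sup>2 * (N * (x \<bullet> x))"
        by (intro mult_left_mono) auto
      moreover have "2 * e * (c * (x \<bullet> x)) \<le> 2 * e * (A x \<bullet> x)"
        using coercive e by (intro mult_left_mono) auto
      ultimately show ?thesis by linarith
    qed
    also have "\<dots> = (1 - 2 * e * c + e\<^sup>2 * N) * (x \<bullet> x)"
      by (simp add: algebra_simps)
    also have "\<dots> \<le> k\<^sup>2 * (x \<bullet> x)"
    proof (rule mult_right_mono)
      have "e\<^sup>2 * N \<le> e\<^sup>2 * (N + 1)" by (intro mult_left_mono) auto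
      also have "\<dots> = c\<^sup>2 / (N + 1)"
        using N by (simp add: e_def power2_eq_square divide_simps)
      finally have "1 - 2 * e * c + e\<^sup>2 * N \<le> 1 - c\<^sup>2 / (N + 1)"
        using N by (simp add: e_def power2_eq_square)
      then show "1 - 2 * e * c + e\<^sup>2 * N \<le> k\<^sup>2" by (simp add: k_def)
    qed auto
    finally show "(norm ((id_blinfun - e *\<^sub>R A) x))\<^sup>2 \<le> (k * norm x)\<^sup>2"
      by (simp add: power_mult_distrib power2_norm_eq_inner)
  qed (use k in auto)
  then have "norm (id_blinfun - e *\<^sub>R A) \<le> k"
    using k by (intro norm_blinfun_bound) auto
  with e k that show ?thesis by force
qed

text \<open>A Lax-Milgram argument: a fixed point of the contraction
  \<open>x \<mapsto> T x + e *\<^sub>R y\<close> solves \<open>A x = y\<close>, while coercivity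
  gives injectivity and the bound \<open>1 / c\<close> for the inverse.\<close>

lemma op_invertible_coercive:
  fixes A :: "'a::complex_hilbert_space op"
  assumes BH: "A \<in> BH" and c: "c > 0" and coercive: "\<And>x. c * (x \<bullet> x) \<le> A x \<bullet> x"
  shows "op_invertible A"
proof -
  obtain e where e: "e > 0" "norm (id_blinfun - e *\<^sub>R A) < 1"
    using coercive_relaxation[OF c coercive] by metis
  define T where "T = id_blinfun - e *\<^sub>R A"
  have "\<exists>x. A x = y" for y
  proof -
    have "\<exists>!x. T x + e *\<^sub>R y = x"
    proof (rule banach_fix_type)
      show "\<forall>u v. dist (T u + e *\<^sub>R y) (T v + e *\<^sub>R y) \<le> norm T * dist u v"
        by (simp add: dist_norm norm_blinfun flip: blinfun.diff_right)
    qed (use e in \<open>auto simp: T_def\<close>)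
    then obtain x where "T x + e *\<^sub>R y = x" by auto
    then have "e *\<^sub>R (y - A x) = 0"
      by (simp add: T_def blinfun.bilinear_simps algebra_simps)
    then show ?thesis using e by auto
  qed
  then obtain B where R: "\<And>y. A (B y) = y" by metis
  have bound: "c * norm x \<le> norm (A x)" for x
  proof (cases "x = 0")
    case False
    have "c * norm x * norm x \<le> norm (A x) * norm x"
      using coercive[of x] norm_cauchy_schwarz[of "A x" x]
      by (simp add: power2_norm_eq_inner[symmetric] power2_eq_square)
    then show ?thesis using False by simp
  qed simp
  have inj: "x = y" if "A x = A y" for x y
  proof -
    have "c * norm (x - y) \<le> 0"
      using bound[of "x - y"] that by (simp add: blinfun.bilinear_simps)
    then show ?thesis using c by (simp add: mult_le_0_iff)
  qed
  have "bounded_linear B"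
  proof (rule bounded_linear_intro)
    fix x y r
    show "B (x + y) = B x + B y" by (rule inj) (simp add: R blinfun.bilinear_simps)
    show "B (r *\<^sub>R x) = r *\<^sub>R B x" by (rule inj) (simp add: R blinfun.bilinear_simps)
    show "norm (B x) \<le> norm x * (1 / c)"
      using bound[of "B x"] c by (simp add: R field_simps)
  qed
  then have B: "blinfun_apply (Blinfun B) = B" by (rule bounded_linear_Blinfun_apply)
  have "Blinfun B \<in> BH"
  proof -
    have "B (z *\<^sub>C x) = z *\<^sub>C B x" for z x
      by (rule inj) (simp add: R BH_D[OF BH])
    then show ?thesis by (simp add: BH_def B)
  qed
  moreover have "B (A x) = x" for x
    by (rule inj) (rule R)
  then have "A o\<^sub>L Blinfun B = id_blinfun" "Blinfun B o\<^sub>L A = id_blinfun"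
    by (auto intro!: blinfun_eqI simp: B R)
  ultimately show ?thesis by (auto simp: op_invertible_def)
qed

text \<open>For the forward direction, positivity is tested at \<open>x - s *\<^sub>R A x\<close>,
  which yields \<open>s * (norm (A x))\<^sup>2 \<le> A x \<bullet> x\<close>; invertibility then
  bounds \<open>norm (A x)\<close> from below. Square roots are constructed from this
  characterization.\<close>

lemma BH_pd_iff:
  "A \<in> BH_pd \<longleftrightarrow> A \<in> BH_sa \<and> (\<exists>c>0. \<forall>x. c * (x \<bullet> x) \<le> A x \<bullet> x)"
proof
  assume A: "A \<in> BH_pd"
  then have sa: "A \<in> BH_sa" and pos: "\<And>x. 0 \<le> A x \<bullet> x"
    by (auto simp: BH_pd_def BH_pos_iff)
  obtain d where d: "d > 0" "\<And>x. d * norm x \<le> norm (A x)"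
    using A by (auto simp: BH_pd_def elim: op_invertible_bounded_below)
  \<comment> \<open>The condition \<open>s * norm A \<le> 1\<close> lets the term quadratic in
    \<open>s\<close> absorb only one of the two copies of
    \<open>s * (norm (A x))\<^sup>2\<close>.\<close>
  define s where "s = 1 / (norm A + 1)"
  have s: "s > 0" "s * norm A \<le> 1" by (auto simp: s_def field_simps add_pos_nonneg add_nonneg_pos)
  have "s * d\<^sup>2 * (x \<bullet> x) \<le> A x \<bullet> x" for x
  proof -
    have "A (A x) \<bullet> A x \<le> norm A * (norm (A x))\<^sup>2"
    proof -
      have "A (A x) \<bullet> A x \<le> norm (A (A x)) * norm (A x)" by (rule norm_cauchy_schwarz)
      also have "\<dots> \<le> norm A * norm (A x) * norm (A x)"
        by (intro mult_right_mono norm_blinfun) auto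
      finally show ?thesis by (simp add: power2_eq_square mult.assoc)
    qed
    then have "s\<^sup>2 * (A (A x) \<bullet> A x) \<le> s\<^sup>2 * (norm A * (norm (A x))\<^sup>2)"
      by (intro mult_left_mono) auto
    also have "\<dots> = s * (norm (A x))\<^sup>2 * (s * norm A)" by (simp add: power2_eq_square)
    also have "\<dots> \<le> s * (norm (A x))\<^sup>2 * 1" using s by (intro mult_left_mono) auto
    finally have *: "s\<^sup>2 * (A (A x) \<bullet> A x) \<le> s * (norm (A x))\<^sup>2" by simp
    have "0 \<le> A (x - s *\<^sub>R A x) \<bullet> (x - s *\<^sub>R A x)" by (rule pos)
    also have "\<dots> = A x \<bullet> x - 2 * s * (norm (A x))\<^sup>2 + s\<^sup>2 * (A (A x) \<bullet> A x)"
      unfolding power2_norm_eq_inner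
      by (simp add: blinfun.bilinear_simps inner_simps BH_sa_D(2)[OF sa] power2_eq_square
          algebra_simps)
    finally have "s * (norm (A x))\<^sup>2 \<le> A x \<bullet> x" using * by linarith
    moreover have "s * (d * norm x)\<^sup>2 \<le> s * (norm (A x))\<^sup>2"
      using d s by (intro mult_left_mono power_mono) auto
    ultimately show ?thesis by (simp add: power_mult_distrib power2_norm_eq_inner)
  qed
  then show "A \<in> BH_sa \<and> (\<exists>c>0. \<forall>x. c * (x \<bullet> x) \<le> A x \<bullet> x)"
    using sa s(1) d(1) by (intro conjI exI[of _ "s * d\<^sup>2"]) auto
next
  assume A: "A \<in> BH_sa \<and> (\<exists>c>0. \<forall>x. c * (x \<bullet> x) \<le> A x \<bullet> x)"
  then obtain c where c: "c > 0" "\<And>x. c * (x \<bullet> x) \<le> A x \<bullet> x" by auto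
  then have "0 \<le> A x \<bullet> x" for x
    by (meson inner_ge_zero less_imp_le mult_nonneg_nonneg order_trans)
  then show "A \<in> BH_pd"
    using A op_invertible_coercive[OF _ c] by (auto simp: BH_pd_def BH_pos_iff BH_sa_D(1))
qed

lemma BH_pd_E:
  assumes "A \<in> BH_pd"
  obtains c where "c > 0" "\<And>x. c * (x \<bullet> x) \<le> A x \<bullet> x"
  using assms by (auto simp: BH_pd_iff)

lemma BH_pd_sa: "A \<in> BH_pd \<Longrightarrow> A \<in> BH_sa"
  by (simp add: BH_pd_iff)

section \<open>Polynomials of a self-adjoint operator\<close>

text \<open>The free bound \<open>n\<close> allows polynomials of different degrees to be expanded
  over one index range.\<close>

lemma op_poly_apply:
  assumes "degree p \<le> n"
  shows "op_poly p A x = (\<Sum>i\<le>n. coeff p i *\<^sub>R (blinfun_apply A ^^ i) x)"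
proof -
  have pow: "(((\<lambda>B. A o\<^sub>L B) ^^ i) id_blinfun) x = (blinfun_apply A ^^ i) x" for i
    by (induction i) auto
  have "op_poly p A x = (\<Sum>i\<le>degree p. coeff p i *\<^sub>R (blinfun_apply A ^^ i) x)"
    by (simp add: op_poly_def blinfun.bilinear_simps pow)
  also have "\<dots> = (\<Sum>i\<le>n. coeff p i *\<^sub>R (blinfun_apply A ^^ i) x)"
    using assms by (intro sum.mono_neutral_left) (auto simp: coeff_eq_0)
  finally show ?thesis .
qed

lemma op_poly_0 [simp]: "op_poly 0 A = 0"
  by (simp add: op_poly_def)

lemma op_poly_add: "op_poly (p + q) A = op_poly p A + op_poly q A"
proof (rule blinfun_eqI)
  fix x
  let ?n = "max (degree p) (degree q)"
  have "degree (p + q) \<le> ?n" by (rule degree_add_le_max)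
  then show "op_poly (p + q) A x = (op_poly p A + op_poly q A) x"
    by (simp add: op_poly_apply[of _ ?n] blinfun.bilinear_simps scaleR_add_left sum.distrib)
qed

lemma op_poly_smult: "op_poly (smult c p) A = c *\<^sub>R op_poly p A"
  by (rule blinfun_eqI)
    (simp add: op_poly_apply[of _ "degree p"] blinfun.bilinear_simps scaleR_sum_right)

lemma op_poly_diff: "op_poly (p - q) A = op_poly p A - op_poly q A"
  using op_poly_add[of "p - q" q A] by simp

lemma op_poly_pCons: "op_poly (pCons a p) A = a *\<^sub>R id_blinfun + (A o\<^sub>L op_poly p A)"
proof (rule blinfun_eqI)
  fix x
  have "degree (pCons a p) \<le> Suc (degree p)" by (simp add: degree_pCons_le)
  then have "op_poly (pCons a p) A x
    = a *\<^sub>R x + (\<Sum>i\<le>degree p. coeff p i *\<^sub>R A ((blinfun_apply A ^^ i) x))"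
    by (simp add: op_poly_apply sum.atMost_Suc_shift del: sum.atMost_Suc)
  also have "\<dots> = (a *\<^sub>R id_blinfun + (A o\<^sub>L op_poly p A)) x"
    by (simp add: op_poly_apply[of p "degree p"] blinfun.bilinear_simps)
  finally show "op_poly (pCons a p) A x = (a *\<^sub>R id_blinfun + (A o\<^sub>L op_poly p A)) x" .
qed

lemma op_poly_linear: "op_poly [:a, 1:] A = a *\<^sub>R id_blinfun + A"
  by (rule blinfun_eqI) (simp add: op_poly_pCons blinfun.bilinear_simps)

lemma op_poly_mult: "op_poly (p * q) A = op_poly p A o\<^sub>L op_poly q A"
proof (induction p)
  case (pCons a p)
  then show ?case
    by (auto intro!: blinfun_eqI simp: op_poly_pCons op_poly_add op_poly_smult blinfun.bilinear_simps)
qed simp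

text \<open>Needed to view a polynomial in \<open>S o\<^sub>L S\<close> as a polynomial in
  \<open>S\<close>.\<close>

lemma op_poly_pcompose: "op_poly (pcompose p q) A = op_poly p (op_poly q A)"
proof (induction p)
  case (pCons a p)
  then show ?case
    by (auto intro!: blinfun_eqI
      simp: pcompose_pCons op_poly_pCons op_poly_add op_poly_mult blinfun.bilinear_simps)
qed simp

lemma op_poly_commute: "A o\<^sub>L op_poly p A = op_poly p A o\<^sub>L A"
  using op_poly_mult[of "[:0, 1:]" p A] op_poly_mult[of p "[:0, 1:]" A]
  by (simp add: op_poly_linear mult.commute)

lemma op_poly_sa:
  assumes "A \<in> BH_sa"
  shows "op_poly p A \<in> BH_sa"
proof (induction p)
  case 0
  show ?case by (simp add: BH_sa_def BH_def scaleC_diff_right[of _ 0 0, simplified])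
next
  case (pCons a p)
  then show ?case
    unfolding op_poly_pCons
    using assms by (intro BH_sa_add BH_sa_scaleR BH_sa_id BH_sa_commuting_compose op_poly_commute)
qed

section \<open>Norm bounds from the real spectrum\<close>

text \<open>If neither \<open>N = norm A\<close> nor \<open>- N\<close> were spectral, the product
  \<open>T\<close> of the two shifted operators would be bounded below, and this would force
  \<open>A\<close> to have norm strictly below \<open>N\<close>.\<close>

lemma norm_bound_by_real_spectrum:
  fixes A :: "'a::complex_hilbert_space op"
  assumes nonzero: "\<exists>x::'a. x \<noteq> 0" and A: "A \<in> BH_sa"
    and bound: "\<And>t. t \<in> real_spectrum A \<Longrightarrow> \<bar>t\<bar> \<le> K"
  shows "norm A \<le> K"
proof -
  define N where "N = norm A"
  note BH = BH_sa_D(1)[OF A] and sym = BH_sa_D(2)[OF A]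
  have "N \<in> real_spectrum A \<or> - N \<in> real_spectrum A"
  proof (rule ccontr)
    assume "\<not> (N \<in> real_spectrum A \<or> - N \<in> real_spectrum A)"
    then have inv: "op_invertible (A - N *\<^sub>R id_blinfun)" "op_invertible (A - (- N) *\<^sub>R id_blinfun)"
      by (auto simp: real_spectrum_def)
    define T where "T = (A - N *\<^sub>R id_blinfun) o\<^sub>L (A - (- N) *\<^sub>R id_blinfun)"
    have T: "T x = A (A x) - N\<^sup>2 *\<^sub>R x" for x
      by (simp add: T_def blinfun.bilinear_simps algebra_simps power2_eq_square)
    obtain c where c: "c > 0" "\<And>x. c * norm x \<le> norm (T x)"
      using op_invertible_bounded_below[OF op_invertible_compose[OF inv]] unfolding T_def by metis
    \<comment> \<open>Expand \<open>(norm (T x))\<^sup>2\<close> and estimate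
      \<open>norm (A (A x))\<close> by \<open>N * norm (A x)\<close>.\<close>
    have key: "c\<^sup>2 * (norm x)\<^sup>2 \<le> N\<^sup>2 * (N\<^sup>2 * (norm x)\<^sup>2 - (norm (A x))\<^sup>2)" for x
    proof -
      have "(c * norm x)\<^sup>2 \<le> (norm (T x))\<^sup>2" using c by (intro power_mono) auto
      also have "\<dots> = (norm (A (A x)))\<^sup>2 - 2 * N\<^sup>2 * (norm (A x))\<^sup>2 + (N\<^sup>2)\<^sup>2 * (norm x)\<^sup>2"
        unfolding power2_norm_eq_inner
        by (simp add: T inner_simps sym[of x "A x"] inner_commute power2_eq_square algebra_simps)
      also have "(norm (A (A x)))\<^sup>2 \<le> (N * norm (A x))\<^sup>2"
        unfolding N_def by (intro power_mono norm_blinfun) auto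
      finally show ?thesis by (simp add: power_mult_distrib power2_eq_square algebra_simps)
    qed
    obtain y :: 'a where y: "y \<noteq> 0" using nonzero by auto
    have "N \<noteq> 0"
    proof
      assume "N = 0"
      moreover have "0 < c\<^sup>2 * (norm y)\<^sup>2" using c y by simp
      ultimately show False using key[of y] by simp
    qed
    then have N: "N > 0" by (simp add: N_def)
    \<comment> \<open>Dividing \<open>key\<close> by \<open>N\<^sup>2\<close> shows that
      \<open>k\<close> bounds \<open>A\<close>; the maximum with 0 keeps the radicand
      nonnegative.\<close>
    define k where "k = sqrt (max 0 (N\<^sup>2 - c\<^sup>2 / N\<^sup>2))"
    have "norm (A x) \<le> k * norm x" for x
    proof (rule power2_le_imp_le)
      have "(norm (A x))\<^sup>2 \<le> (N\<^sup>2 - c\<^sup>2 / N\<^sup>2) * (norm x)\<^sup>2"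
        using key[of x] N by (simp add: field_simps)
      also have "\<dots> \<le> k\<^sup>2 * (norm x)\<^sup>2" by (intro mult_right_mono) (auto simp: k_def)
      finally show "(norm (A x))\<^sup>2 \<le> (k * norm x)\<^sup>2" by (simp add: power_mult_distrib)
    qed (simp add: k_def)
    then have "N \<le> k" unfolding N_def by (intro norm_blinfun_bound) (auto simp: k_def)
    moreover have "k < N"
    proof (rule power2_less_imp_less)
      show "k\<^sup>2 < N\<^sup>2" using N c by (auto simp: k_def)
    qed (use N in auto)
    ultimately show False by simp
  qed
  then show ?thesis using bound by (fastforce simp: N_def)
qed

text \<open>The polynomial is \<open>(t - a)\<^sup>2 + b\<^sup>2\<close>; at a self-adjoint operator
  the first square contributes a nonnegative form, so the value is coercive with constant
  \<open>b\<^sup>2\<close>.\<close>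

lemma op_invertible_quadratic:
  assumes A: "A \<in> BH_sa" and "b \<noteq> 0"
  shows "op_invertible (op_poly [:a\<^sup>2 + b\<^sup>2, - 2 * a, 1:] A)"
proof (rule op_invertible_coercive)
  let ?T = "op_poly [:a\<^sup>2 + b\<^sup>2, - 2 * a, 1:] A"
  show "?T \<in> BH" using op_poly_sa[OF A] by (rule BH_sa_D)
  fix x
  have "?T x \<bullet> x = (A x - a *\<^sub>R x) \<bullet> (A x - a *\<^sub>R x) + b\<^sup>2 * (x \<bullet> x)"
    by (simp add: op_poly_pCons blinfun.bilinear_simps inner_simps BH_sa_D(2)[OF A, of x "A x"]
        inner_commute power2_eq_square algebra_simps)
  then show "b\<^sup>2 * (x \<bullet> x) \<le> ?T x \<bullet> x" by simp
qed (use assms in auto)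

text \<open>Take a complex root \<open>a + b * \<i>\<close>: if it is real it splits off a linear
  factor, otherwise its real minimal polynomial divides \<open>p\<close>.\<close>

lemma real_poly_factor:
  fixes p :: "real poly"
  assumes "degree p > 0"
  obtains (linear) a where "[:- a, 1:] dvd p"
  | (quadratic) a b where "b \<noteq> 0" "[:a\<^sup>2 + b\<^sup>2, - 2 * a, 1:] dvd p"
proof -
  have "degree (map_poly complex_of_real p) > 0"
    using assms by (simp add: degree_map_poly)
  then obtain z where z: "poly (map_poly complex_of_real p) z = 0"
    using Fundamental_Theorem_Algebra.fundamental_theorem_of_algebra constant_degree by (metis less_irrefl)
  define a b where "a = Re z" and "b = Im z"
  show ?thesis
  proof (cases "b = 0")
    case True
    then have "z = of_real a" by (simp add: a_def b_def complex_eq_iff)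
    moreover have "poly (map_poly complex_of_real p) (of_real a) = of_real (poly p a)"
      by (simp add: poly_altdef degree_map_poly coeff_map_poly)
    ultimately have "poly p a = 0" using z by simp
    then show ?thesis using linear by (simp add: poly_eq_0_iff_dvd)
  next
    case False
    define q where "q = [:a\<^sup>2 + b\<^sup>2, - 2 * a, 1:]"
    have qz: "poly (map_poly complex_of_real q) z = 0"
      by (simp add: q_def map_poly_pCons a_def b_def complex_eq_iff power2_eq_square algebra_simps)
    \<comment> \<open>The remainder has degree at most 1 and real coefficients, so vanishing at the
      nonreal \<open>z\<close> forces it to be zero.\<close>
    define r where "r = p mod q"
    have "degree r < 2"
      using degree_mod_less[of q p] by (auto simp: r_def q_def)
    then have "r = [:coeff r 0, coeff r 1:]"
      by (intro poly_eqI) (auto simp: coeff_pCons coeff_eq_0 split: nat.split)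
    then obtain u v where r: "r = [:u, v:]" by blast
    have "map_poly complex_of_real (q * (p div q) + r)
      = map_poly complex_of_real q * map_poly complex_of_real (p div q) + map_poly complex_of_real r"
      by (intro poly_eqI) (simp add: coeff_map_poly coeff_mult)
    then have "map_poly complex_of_real p
      = map_poly complex_of_real q * map_poly complex_of_real (p div q) + map_poly complex_of_real r"
      by (simp add: r_def)
    then have "poly (map_poly complex_of_real r) z = 0" using z qz by simp
    then have "of_real u + z * of_real v = 0" by (simp add: r map_poly_pCons)
    then have uv: "u + Re z * v = 0" "Im z * v = 0" by (simp_all add: complex_eq_iff)
    then have "v = 0" using False by (simp add: b_def)
    moreover from this have "u = 0" using uv by simp
    ultimately have "r = 0" by (simp add: r)
    then have "q dvd p" by (simp add: r_def dvd_eq_mod_eq_0)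
    then show ?thesis using quadratic False by (simp add: q_def)
  qed
qed

text \<open>Real factors are split off one at a time. Quadratic factors without real roots are
  invertible at \<open>A\<close>, so a failure of invertibility must come from a linear factor,
  whose root is then a spectral value.\<close>

lemma real_spectrum_root:
  assumes A: "A \<in> BH_sa"
  shows "p \<noteq> 0 \<Longrightarrow> \<not> op_invertible (op_poly p A) \<Longrightarrow> \<exists>t\<in>real_spectrum A. poly p t = 0"
proof (induction "degree p" arbitrary: p rule: less_induct)
  case less
  show ?case
  proof (cases "degree p = 0")
    case True
    then obtain a where a: "p = [:a:]" by (rule degree_eq_zeroE)
    then have "op_poly p A = a *\<^sub>R id_blinfun" "a \<noteq> 0"
      using less.prems by (auto simp: op_poly_pCons)
    then show ?thesis
      using less.prems op_invertible_scaleR[OF op_invertible_id] by auto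
  next
    case False
    then have "degree p > 0" by simp
    then obtain q s where p: "p = q * s" and q: "degree q > 0"
      and qA: "op_invertible (op_poly q A) \<or> (\<exists>t\<in>real_spectrum A. poly q t = 0)"
    proof (cases rule: real_poly_factor)
      case (linear a)
      have "op_poly [:- a, 1:] A = A - a *\<^sub>R id_blinfun"
        by (simp add: op_poly_linear)
      then have "op_invertible (op_poly [:- a, 1:] A) \<or> (\<exists>t\<in>real_spectrum A. poly [:- a, 1:] t = 0)"
        by (auto simp: real_spectrum_def)
      with linear that[of "[:- a, 1:]"] show ?thesis by (auto elim!: dvdE)
    next
      case (quadratic a b)
      with op_invertible_quadratic[OF A] that[of "[:a\<^sup>2 + b\<^sup>2, - 2 * a, 1:]"]
      show ?thesis by (auto elim!: dvdE)
    qed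
    have "s \<noteq> 0" "q \<noteq> 0" using less.prems p by auto
    then have deg: "degree s < degree p" using q by (simp add: p degree_mult_eq)
    from qA show ?thesis
    proof
      assume "op_invertible (op_poly q A)"
      then have "\<not> op_invertible (op_poly s A)"
        using less.prems op_invertible_compose by (auto simp: p op_poly_mult)
      then show ?thesis using less.hyps[OF deg \<open>s \<noteq> 0\<close>] by (auto simp: p)
    qed (auto simp: p)
  qed
qed

text \<open>The inclusion half of spectral mapping: if \<open>s\<close> is spectral for
  \<open>p(A)\<close>, the root lemma applied to \<open>p - [:s:]\<close> shows that
  \<open>s\<close> is a value of \<open>p\<close> on the spectrum of \<open>A\<close>.\<close>

lemma norm_op_poly_le:
  fixes A :: "'a::complex_hilbert_space op"
  assumes nonzero: "\<exists>x::'a. x \<noteq> 0" and A: "A \<in> BH_sa"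
    and bound: "\<And>t. t \<in> real_spectrum A \<Longrightarrow> \<bar>poly p t\<bar> \<le> K"
  shows "norm (op_poly p A) \<le> K"
proof (rule norm_bound_by_real_spectrum[OF nonzero op_poly_sa[OF A]])
  fix s assume "s \<in> real_spectrum (op_poly p A)"
  then have s: "\<not> op_invertible (op_poly (p - [:s:]) A)"
    by (simp add: real_spectrum_def op_poly_diff op_poly_pCons)
  have "\<exists>t\<in>real_spectrum A. poly (p - [:s:]) t = 0"
  proof (cases "p - [:s:] = 0")
    case True
    \<comment> \<open>For an empty spectrum the norm bound would hold vacuously with
      \<open>-1\<close>, contradicting nonnegativity of the norm.\<close>
    have "real_spectrum A \<noteq> {}"
      using norm_bound_by_real_spectrum[OF nonzero A, of "-1"] norm_ge_zero[of A]
      by (metis empty_iff neg_0_le_iff_le not_one_le_zero order_trans)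
    with True show ?thesis by auto
  next
    case False
    then show ?thesis using real_spectrum_root[OF A _ s] by auto
  qed
  then show "\<bar>s\<bar> \<le> K" using bound by auto
qed

section \<open>Square roots and functional calculus\<close>

lemma BH_pd_subset_pos: "A \<in> BH_pd \<Longrightarrow> A \<in> BH_pos"
  by (simp add: BH_pd_def)

lemma BH_pd_scaleR:
  assumes "A \<in> BH_pd" "r > 0"
  shows "r *\<^sub>R A \<in> BH_pd"
proof -
  obtain c where c: "c > 0" "\<And>x. c * (x \<bullet> x) \<le> A x \<bullet> x"
    using assms(1) by (rule BH_pd_E) blast
  have "(r * c) * (x \<bullet> x) \<le> (r *\<^sub>R A) x \<bullet> x" for x
    using c(2)[of x] assms(2) by (simp add: blinfun.bilinear_simps mult.assoc)
  then show ?thesis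
    unfolding BH_pd_iff using assms BH_pd_sa c(1) by (intro conjI exI[of _ "r * c"]) auto
qed

lemma id_BH_pd: "id_blinfun \<in> BH_pd"
  by (auto simp: BH_pd_iff intro: exI[of _ 1])

text \<open>This is the complete set on which the square root iteration runs. Each defining
  condition passes to norm limits.\<close>

lemma closed_commuting_ball:
  fixes b :: real
  shows "closed {Y :: 'a::complex_hilbert_space op.
    Y \<in> BH_sa \<and> norm Y \<le> b \<and> (\<forall>T. T o\<^sub>L B = B o\<^sub>L T \<longrightarrow> T o\<^sub>L Y = Y o\<^sub>L T)}"
  unfolding closed_sequential_limits
proof (intro allI impI, elim conjE)
  fix X :: "nat \<Rightarrow> 'a op" and L
  assume X: "\<forall>n. X n \<in> {Y. Y \<in> BH_sa \<and> norm Y \<le> b \<and> (\<forall>T. T o\<^sub>L B = B o\<^sub>L T \<longrightarrow> T o\<^sub>L Y = Y o\<^sub>L T)}"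
    and L: "X \<longlonglongrightarrow> L"
  have Xn: "X n \<in> BH_sa" "norm (X n) \<le> b" "T o\<^sub>L B = B o\<^sub>L T \<Longrightarrow> T o\<^sub>L X n = X n o\<^sub>L T" for n T
    using X unfolding mem_Collect_eq by blast+
  have lim: "(\<lambda>n. X n x) \<longlonglongrightarrow> L x" for x
    using L by (intro tendsto_intros)
  have "L (c *\<^sub>C x) = c *\<^sub>C L x" for c x
  proof -
    \<comment> \<open>Complex linearity survives the limit because multiplication by
      \<open>c\<close> is continuous; its norm is computed through \<open>cinner\<close>.\<close>
    have "bounded_linear (\<lambda>y::'a. c *\<^sub>C y)"
    proof (rule bounded_linear_intro)
      fix y :: 'a
      show "norm (c *\<^sub>C y) \<le> norm y * cmod c"
      proof (rule power2_le_imp_le)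
        have "cinner (c *\<^sub>C y) (c *\<^sub>C y) = of_real ((cmod c)\<^sup>2) * cinner y y"
          unfolding cinner_scaleC_left cinner_scaleC_right complex_norm_square by (simp add: mult_ac)
        then show "(norm (c *\<^sub>C y))\<^sup>2 \<le> (norm y * cmod c)\<^sup>2"
          by (simp add: power2_norm_eq_inner inner_eq_Re_cinner power_mult_distrib)
      qed auto
    qed (auto simp: scaleC_add_right scaleC_scaleR_commute)
    from bounded_linear.tendsto[OF this lim[of x]]
    have "(\<lambda>n. X n (c *\<^sub>C x)) \<longlonglongrightarrow> c *\<^sub>C L x"
      by (simp add: BH_D[OF BH_sa_D(1)[OF Xn(1)]])
    with lim[of "c *\<^sub>C x"] show ?thesis by (rule LIMSEQ_unique)
  qed
  moreover have "L x \<bullet> y = x \<bullet> L y" for x y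
    using tendsto_inner[OF lim[of x] tendsto_const[of y]] tendsto_inner[OF tendsto_const[of x] lim[of y]]
    unfolding BH_sa_D(2)[OF Xn(1)] by (rule LIMSEQ_unique)
  ultimately have sa: "L \<in> BH_sa" by (simp add: BH_sa_def BH_def)
  have norm: "norm L \<le> b"
    using tendsto_norm[OF L] Xn(2) by (intro LIMSEQ_le_const2) auto
  have comm: "T o\<^sub>L L = L o\<^sub>L T" if T: "T o\<^sub>L B = B o\<^sub>L T" for T
  proof -
    have "(\<lambda>n. T o\<^sub>L X n) \<longlonglongrightarrow> (T o\<^sub>L L)" "(\<lambda>n. X n o\<^sub>L T) \<longlonglongrightarrow> (L o\<^sub>L T)"
      by (intro bounded_bilinear.tendsto[OF bounded_bilinear_blinfun_compose] L tendsto_const)+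
    then show ?thesis unfolding Xn(3)[OF T] by (rule LIMSEQ_unique)
  qed
  show "L \<in> {Y. Y \<in> BH_sa \<and> norm Y \<le> b \<and> (\<forall>T. T o\<^sub>L B = B o\<^sub>L T \<longrightarrow> T o\<^sub>L Y = Y o\<^sub>L T)}"
    by (intro CollectI conjI allI impI sa norm comm)
qed

text \<open>
  Writing \<open>e A = I - B\<close> with \<open>\<parallel>B\<parallel> < 1\<close>, the square root of \<open>e A\<close> is \<open>I - Y\<close>, where \<open>Y\<close> is the fixed
  point of the contraction \<open>Y \<mapsto> (B + Y\<^sup>2) / 2\<close>.
\<close>

lemma BH_pd_sqrt_exists:
  assumes A: "A \<in> BH_pd"
  obtains S where "S \<in> BH_pd" "S o\<^sub>L S = A" "\<And>T. T o\<^sub>L A = A o\<^sub>L T \<Longrightarrow> T o\<^sub>L S = S o\<^sub>L T"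
proof -
  obtain c where c: "c > 0" "\<And>x. c * (x \<bullet> x) \<le> A x \<bullet> x"
    using A by (rule BH_pd_E) blast
  obtain e where e: "e > 0" "norm (id_blinfun - e *\<^sub>R A) < 1"
    using coercive_relaxation[OF c] .
  define B where "B = id_blinfun - e *\<^sub>R A"
  define b where "b = norm B"
  have b: "0 \<le> b" "b < 1" using e by (auto simp: b_def B_def)
  have B: "B \<in> BH_sa" unfolding B_def by (intro BH_sa_diff BH_sa_id BH_sa_scaleR BH_pd_sa A)
  \<comment> \<open>Commutation with everything that commutes with \<open>B\<close> is carried
    through the iteration, since uniqueness of the root depends on it.\<close>
  define \<Y> where "\<Y> = {Y. Y \<in> BH_sa \<and> norm Y \<le> b \<and> (\<forall>T. T o\<^sub>L B = B o\<^sub>L T \<longrightarrow> T o\<^sub>L Y = Y o\<^sub>L T)}"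
  define g where "g = (\<lambda>Y. (1/2) *\<^sub>R (B + (Y o\<^sub>L Y)))"
  have "\<exists>!Y\<in>\<Y>. g Y = Y"
  proof (rule Banach_fix[where c = b])
    show "complete \<Y>" unfolding \<Y>_def complete_eq_closed by (rule closed_commuting_ball)
    have "B \<in> \<Y>" using B by (simp add: \<Y>_def b_def)
    then show "\<Y> \<noteq> {}" by blast
    show "g ` \<Y> \<subseteq> \<Y>"
    proof (rule image_subsetI)
      fix Y assume "Y \<in> \<Y>"
      then have Y: "Y \<in> BH_sa" "norm Y \<le> b" "\<And>T. T o\<^sub>L B = B o\<^sub>L T \<Longrightarrow> T o\<^sub>L Y = Y o\<^sub>L T"
        unfolding \<Y>_def mem_Collect_eq by blast+
      have "g Y \<in> BH_sa" unfolding g_def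
        by (intro BH_sa_scaleR BH_sa_add BH_sa_commuting_compose B Y(1) refl)
      have "norm (Y o\<^sub>L Y) \<le> norm Y * norm Y" by (rule norm_blinfun_compose)
      also have "\<dots> \<le> 1 * b" using Y(2) b by (intro mult_mono) auto
      finally have "norm (B + (Y o\<^sub>L Y)) \<le> b + b"
        using norm_triangle_ineq[of B "Y o\<^sub>L Y"] by (simp add: b_def)
      then have "norm (g Y) \<le> b" by (simp add: g_def)
      moreover have "T o\<^sub>L g Y = g Y o\<^sub>L T" if T: "T o\<^sub>L B = B o\<^sub>L T" for T
      proof -
        have "T (B x) = B (T x)" for x
          using T by (metis blinfun_apply_blinfun_compose)
        moreover have "T (Y x) = Y (T x)" for x
          using Y(3)[OF T] by (metis blinfun_apply_blinfun_compose)
        ultimately show ?thesis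
          by (auto intro!: blinfun_eqI simp: g_def blinfun.bilinear_simps)
      qed
      ultimately show "g Y \<in> \<Y>" using \<open>g Y \<in> BH_sa\<close>
        unfolding \<Y>_def mem_Collect_eq by blast
    qed
    show "dist (g Y) (g Z) \<le> b * dist Y Z" if "Y \<in> \<Y>" "Z \<in> \<Y>" for Y Z
    proof -
      \<comment> \<open>The difference of squares is split without assuming that \<open>Y\<close>
        and \<open>Z\<close> commute.\<close>
      have "g Y - g Z = (1/2) *\<^sub>R ((Y o\<^sub>L (Y - Z)) + ((Y - Z) o\<^sub>L Z))"
        by (rule blinfun_eqI) (simp add: g_def blinfun.bilinear_simps algebra_simps)
      moreover have "norm ((Y o\<^sub>L (Y - Z)) + ((Y - Z) o\<^sub>L Z)) \<le> b * norm (Y - Z) + norm (Y - Z) * b"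
      proof (rule norm_triangle_mono)
        have "norm Y \<le> b" "norm Z \<le> b" using that unfolding \<Y>_def by blast+
        then show "norm (Y o\<^sub>L (Y - Z)) \<le> b * norm (Y - Z)" "norm ((Y - Z) o\<^sub>L Z) \<le> norm (Y - Z) * b"
          by (meson norm_blinfun_compose order_trans mult_right_mono mult_left_mono norm_ge_zero)+
      qed
      ultimately show ?thesis by (simp add: dist_norm)
    qed
  qed (use b in auto)
  then obtain Y where "Y \<in> \<Y>" and gY: "g Y = Y" by auto
  then have Y: "Y \<in> BH_sa" "norm Y \<le> b" "\<And>T. T o\<^sub>L B = B o\<^sub>L T \<Longrightarrow> T o\<^sub>L Y = Y o\<^sub>L T"
    unfolding \<Y>_def mem_Collect_eq by blast+
  have YY: "Y (Y x) = 2 *\<^sub>R Y x - B x" for x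
  proof -
    have "2 *\<^sub>R Y x = B x + Y (Y x)"
      by (subst gY[symmetric]) (simp add: g_def blinfun.bilinear_simps)
    then show ?thesis by simp
  qed
  \<comment> \<open>The fixed point equation gives \<open>(I - Y)\<^sup>2 = I - B = e A\<close>; the
    factor \<open>1 / sqrt e\<close> undoes the scaling.\<close>
  define S where "S = (1 / sqrt e) *\<^sub>R (id_blinfun - Y)"
  have "S \<in> BH_pd"
  proof -
    have "(1 - b) * (x \<bullet> x) \<le> (id_blinfun - Y) x \<bullet> x" for x
    proof -
      have "Y x \<bullet> x \<le> norm (Y x) * norm x" by (rule norm_cauchy_schwarz)
      also have "\<dots> \<le> norm Y * norm x * norm x" by (intro mult_right_mono norm_blinfun) auto
      also have "\<dots> \<le> b * (x \<bullet> x)"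
        using Y(2) by (auto simp: power2_norm_eq_inner[symmetric] power2_eq_square mult.assoc intro!: mult_right_mono)
      finally show ?thesis by (simp add: blinfun.bilinear_simps inner_simps algebra_simps)
    qed
    then have "id_blinfun - Y \<in> BH_pd"
      unfolding BH_pd_iff using b Y(1) by (intro conjI exI[of _ "1 - b"]) auto
    then show ?thesis unfolding S_def using e by (intro BH_pd_scaleR) auto
  qed
  moreover have "S o\<^sub>L S = A"
  proof (rule blinfun_eqI)
    fix x
    have "(S o\<^sub>L S) x = (1 / sqrt e * (1 / sqrt e)) *\<^sub>R ((x - Y x) - Y (x - Y x))"
      by (simp only: S_def blinfun_apply_blinfun_compose blinfun.bilinear_simps scaleR_scaleR
          scaleR_diff_right blinfun_apply_id_blinfun)
    also have "1 / sqrt e * (1 / sqrt e) = 1 / e" using e by (simp add: field_simps)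
    also have "(x - Y x) - Y (x - Y x) = e *\<^sub>R A x"
      by (simp add: blinfun.bilinear_simps YY B_def scaleR_2)
    finally show "(S o\<^sub>L S) x = A x" using e by simp
  qed
  moreover have "T o\<^sub>L S = S o\<^sub>L T" if T: "T o\<^sub>L A = A o\<^sub>L T" for T
  proof -
    have "T (A x) = A (T x)" for x
      using T by (metis blinfun_apply_blinfun_compose)
    then have "T o\<^sub>L B = B o\<^sub>L T"
      by (auto intro!: blinfun_eqI simp: B_def blinfun.bilinear_simps)
    then have "T (Y x) = Y (T x)" for x
      using Y(3) by (metis blinfun_apply_blinfun_compose)
    then show ?thesis
      by (auto intro!: blinfun_eqI simp: S_def blinfun.bilinear_simps)
  qed
  ultimately show ?thesis using that by blast
qed

text \<open>Another root \<open>S'\<close> commutes with its square \<open>A\<close>, hence with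
  \<open>S\<close>, so \<open>(S' - S) (S + S') = 0\<close>. Coercivity of \<open>S\<close> makes
  \<open>S + S'\<close> surjective, and therefore \<open>S' = S\<close>.\<close>

lemma BH_pd_sqrt_ex1:
  assumes A: "A \<in> BH_pd"
  shows "\<exists>!S. S \<in> BH_pos \<and> S o\<^sub>L S = A"
proof -
  obtain S where S: "S \<in> BH_pd" "S o\<^sub>L S = A" and comm: "\<And>T. T o\<^sub>L A = A o\<^sub>L T \<Longrightarrow> T o\<^sub>L S = S o\<^sub>L T"
    using BH_pd_sqrt_exists[OF A] by metis
  have "S' = S" if S': "S' \<in> BH_pos" "S' o\<^sub>L S' = A" for S'
  proof (rule blinfun_eqI)
    fix x
    have "S' o\<^sub>L A = A o\<^sub>L S'"
      unfolding S'(2)[symmetric] by (rule blinfun_eqI) simp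
    then have c: "S' (S y) = S (S' y)" for y
      using comm by (metis blinfun_apply_blinfun_compose)
    obtain c where c0: "c > 0" "\<And>x. c * (x \<bullet> x) \<le> S x \<bullet> x"
      using S(1) by (rule BH_pd_E) blast
    have "op_invertible (S + S')"
    proof (rule op_invertible_coercive[OF _ c0(1)])
      show "S + S' \<in> BH" using S S' BH_pd_sa BH_sa_D(1) by (auto simp: BH_pos_iff)
      show "c * (x \<bullet> x) \<le> (S + S') x \<bullet> x" for x
        using c0(2)[of x] S'(1) by (auto simp: BH_pos_iff blinfun.bilinear_simps inner_simps add_increasing2)
    qed
    then obtain y where x: "x = (S + S') y"
      unfolding op_invertible_def by (metis blinfun_compose_eq_idD)
    have "S (S y) = S' (S' y)"
      using S(2) S'(2) by (metis blinfun_apply_blinfun_compose)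
    then show "S' x = S x" by (simp add: x blinfun.bilinear_simps c)
  qed
  then show ?thesis using S BH_pd_subset_pos by blast
qed

lemma op_sqrt_eqI:
  assumes "S \<in> BH_pos" "S o\<^sub>L S = A" "A \<in> BH_pd"
  shows "op_sqrt A = S"
  unfolding op_sqrt_def by (rule the1_equality) (use BH_pd_sqrt_ex1 assms in auto)

lemma op_sqrt_BH_pd:
  assumes "A \<in> BH_pd"
  shows "op_sqrt A \<in> BH_pd" "op_sqrt A o\<^sub>L op_sqrt A = A"
proof -
  obtain S where S: "S \<in> BH_pd" "S o\<^sub>L S = A"
    using BH_pd_sqrt_exists[OF assms] by metis
  then have "op_sqrt A = S" using assms by (intro op_sqrt_eqI BH_pd_subset_pos)
  with S show "op_sqrt A \<in> BH_pd" "op_sqrt A o\<^sub>L op_sqrt A = A" by auto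
qed

lemma op_inv_eqI:
  assumes "B \<in> BH" "A o\<^sub>L B = id_blinfun" "B o\<^sub>L A = id_blinfun"
  shows "op_inv A = B"
  unfolding op_inv_def
proof (rule the_equality)
  fix C assume C: "C \<in> BH \<and> A o\<^sub>L C = id_blinfun \<and> C o\<^sub>L A = id_blinfun"
  show "C = B"
  proof (rule blinfun_eqI)
    fix x
    have "C x = C (A (B x))" by (simp add: blinfun_compose_eq_idD[OF assms(2)])
    also have "\<dots> = B x" using C by (intro blinfun_compose_eq_idD) auto
    finally show "C x = B x" .
  qed
qed (use assms in auto)

text \<open>Places the inner operator of both mean formulas in \<open>BH_pd\<close>: with
  \<open>R\<close> the inverse of \<open>S\<close>, the form at \<open>x\<close> is that of
  \<open>B\<close> at \<open>R x\<close>, and both \<open>B\<close> and \<open>R\<close> are bounded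
  below.\<close>

lemma BH_pd_congruence_op_inv:
  assumes S: "S \<in> BH_pd" and B: "B \<in> BH_pd"
  shows "op_inv S o\<^sub>L B o\<^sub>L op_inv S \<in> BH_pd"
proof -
  obtain R where R: "R \<in> BH" "S o\<^sub>L R = id_blinfun" "R o\<^sub>L S = id_blinfun"
    using S by (auto simp: BH_pd_def op_invertible_def)
  then have SR: "S (R x) = x" for x by (simp add: blinfun_compose_eq_idD)
  have "R x \<bullet> y = x \<bullet> R y" for x y
    using BH_sa_D(2)[OF BH_pd_sa[OF S], of "R x" "R y"] by (simp add: SR)
  then have Rsym: "R x \<bullet> y = x \<bullet> R y" for x y .
  have Bsa: "B \<in> BH_sa" using B by (rule BH_pd_sa)
  obtain c where c: "c > 0" "\<And>x. c * (x \<bullet> x) \<le> B x \<bullet> x"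
    using B by (rule BH_pd_E) blast
  have "S \<in> BH" using S by (simp add: BH_pd_sa BH_sa_D(1))
  then have "op_invertible R" using R by (auto simp: op_invertible_def)
  then obtain d where d: "d > 0" "\<And>x. d * norm x \<le> norm (R x)"
    by (rule op_invertible_bounded_below) blast
  have "c * d\<^sup>2 * (x \<bullet> x) \<le> (R o\<^sub>L B o\<^sub>L R) x \<bullet> x" for x
  proof -
    have "c * (d * norm x)\<^sup>2 \<le> c * (norm (R x))\<^sup>2"
      using c d by (intro mult_left_mono power_mono) auto
    also have "\<dots> \<le> B (R x) \<bullet> R x" using c(2)[of "R x"] by (simp add: power2_norm_eq_inner)
    finally show ?thesis by (simp add: Rsym power_mult_distrib power2_norm_eq_inner)
  qed
  moreover have "R o\<^sub>L B o\<^sub>L R \<in> BH_sa"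
    using R(1) Bsa by (auto simp: BH_sa_def Rsym)
  ultimately have "R o\<^sub>L B o\<^sub>L R \<in> BH_pd"
    unfolding BH_pd_iff using c(1) d(1) by (intro conjI exI[of _ "c * d\<^sup>2"]) auto
  then show ?thesis using op_inv_eqI[OF R] by simp
qed

section \<open>Spectra of positive invertible operators and the functional calculus\<close>

lemma op_invertible_uminusD: "op_invertible (- A) \<Longrightarrow> op_invertible (A :: 'a::complex_hilbert_space op)"
  using op_invertible_scaleR[of "- A" "-1"] by simp

text \<open>Outside the interval, \<open>A - t\<close> or \<open>t - A\<close> is coercive. The
  positive left end confines the spectrum to points where \<open>f\<close> is known.\<close>

lemma real_spectrum_BH_pd:
  assumes "A \<in> BH_pd"
  obtains c where "c > 0" "real_spectrum A \<subseteq> {c..norm A}"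
proof -
  obtain c where c: "c > 0" "\<And>x. c * (x \<bullet> x) \<le> A x \<bullet> x"
    using assms by (rule BH_pd_E) blast
  have BH: "A - t *\<^sub>R id_blinfun \<in> BH" "- (A - t *\<^sub>R id_blinfun) \<in> BH" for t
    using assms BH_sa_D(1) BH_pd_sa by auto
  have "c \<le> t \<and> t \<le> norm A" if t: "t \<in> real_spectrum A" for t
  proof (rule ccontr)
    assume "\<not> (c \<le> t \<and> t \<le> norm A)"
    then consider "t < c" | "norm A < t" by linarith
    then have "op_invertible (A - t *\<^sub>R id_blinfun)"
    proof cases
      case 1
      have "(c - t) * (x \<bullet> x) \<le> (A - t *\<^sub>R id_blinfun) x \<bullet> x" for x
        using c(2)[of x] by (simp add: blinfun.bilinear_simps inner_simps algebra_simps)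
      with 1 BH show ?thesis by (intro op_invertible_coercive[of _ "c - t"]) auto
    next
      case 2
      have "(t - norm A) * (x \<bullet> x) \<le> (- (A - t *\<^sub>R id_blinfun)) x \<bullet> x" for x
      proof -
        have "A x \<bullet> x \<le> norm (A x) * norm x" by (rule norm_cauchy_schwarz)
        also have "\<dots> \<le> norm A * norm x * norm x" by (intro mult_right_mono norm_blinfun) auto
        also have "\<dots> = norm A * (x \<bullet> x)"
          by (simp add: power2_norm_eq_inner[symmetric] power2_eq_square)
        finally show ?thesis
          by (simp add: blinfun.bilinear_simps inner_simps algebra_simps)
      qed
      with 2 BH have "op_invertible (- (A - t *\<^sub>R id_blinfun))"
        by (intro op_invertible_coercive[of _ "t - norm A"]) auto
      then show ?thesis by (rule op_invertible_uminusD)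
    qed
    then show False using t by (simp add: real_spectrum_def)
  qed
  then have "real_spectrum A \<subseteq> {c..norm A}" by auto
  with c(1) show ?thesis by (rule that)
qed

text \<open>\<open>S\<^sup>2 - t\<^sup>2\<close> has the commuting factors \<open>S - t\<close> and
  \<open>S + t\<close>, so its invertibility would pass to \<open>S - t\<close>.\<close>

lemma real_spectrum_square:
  assumes S: "S \<in> BH" and t: "t \<in> real_spectrum S"
  shows "t\<^sup>2 \<in> real_spectrum (S o\<^sub>L S)"
proof -
  define P where "P = S - t *\<^sub>R id_blinfun"
  define Q where "Q = S + t *\<^sub>R id_blinfun"
  have "P o\<^sub>L Q = (S o\<^sub>L S) - t\<^sup>2 *\<^sub>R id_blinfun" "P o\<^sub>L Q = Q o\<^sub>L P"
    by (auto intro!: blinfun_eqI simp: P_def Q_def blinfun.bilinear_simps power2_eq_square algebra_simps)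
  moreover have "P \<in> BH" "Q \<in> BH" using S by (auto simp: P_def Q_def)
  ultimately show ?thesis
    using t op_invertible_commuting_factor[of P Q] by (auto simp: real_spectrum_def P_def)
qed

lemma op_poly_tendsto_sqrt:
  fixes S :: "'a::complex_hilbert_space op"
  assumes nonzero: "\<exists>x::'a. x \<noteq> 0" and S: "S \<in> BH_pd"
    and lim: "uniform_limit (real_spectrum (S o\<^sub>L S)) (\<lambda>n. poly (p n)) sqrt sequentially"
  shows "(\<lambda>n. op_poly (p n) (S o\<^sub>L S)) \<longlonglongrightarrow> S"
proof (rule tendstoI)
  fix e :: real assume "e > 0"
  have "\<forall>\<^sub>F n in sequentially. \<forall>u\<in>real_spectrum (S o\<^sub>L S). dist (poly (p n) u) (sqrt u) < e / 2"
    \<comment> \<open>Halving \<open>e\<close> restores strictness, as the spectral estimate only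
      gives a weak inequality.\<close>
    using lim \<open>e > 0\<close> by (intro uniform_limitD) auto
  then show "\<forall>\<^sub>F n in sequentially. dist (op_poly (p n) (S o\<^sub>L S)) S < e"
  proof eventually_elim
    case (elim n)
    let ?q = "pcompose (p n) [:0, 0, 1:] - [:0, 1:]"
    obtain c where c: "c > 0" "real_spectrum S \<subseteq> {c..norm S}"
      using real_spectrum_BH_pd[OF S] .
    have "op_poly [:0, 0, 1:] S = S o\<^sub>L S" "op_poly [:0, 1:] S = S"
      by (auto intro!: blinfun_eqI simp: op_poly_pCons blinfun.bilinear_simps)
    then have "op_poly ?q S = op_poly (p n) (S o\<^sub>L S) - S"
      by (simp only: op_poly_diff op_poly_pcompose)
    moreover have "norm (op_poly ?q S) \<le> e / 2"
    proof (rule norm_op_poly_le[OF nonzero BH_pd_sa[OF S]])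
      fix t assume t: "t \<in> real_spectrum S"
      \<comment> \<open>Positivity of \<open>S\<close> is what selects the right root:
        \<open>sqrt (t\<^sup>2) = t\<close> on its spectrum.\<close>
      then have "t \<ge> 0" using c by auto
      have "t\<^sup>2 \<in> real_spectrum (S o\<^sub>L S)"
        using t S BH_pd_sa BH_sa_D(1) by (intro real_spectrum_square) auto
      then have "\<bar>poly (p n) (t\<^sup>2) - sqrt (t\<^sup>2)\<bar> < e / 2" using elim by (auto simp: dist_real_def)
      then show "\<bar>poly ?q t\<bar> \<le> e / 2"
        using \<open>t \<ge> 0\<close> by (simp add: poly_pcompose power2_eq_square)
    qed
    ultimately show ?case using \<open>e > 0\<close> by (simp add: dist_norm)
  qed
qed

lemma poly_uniform_approximation:
  fixes f :: "real \<Rightarrow> real"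
  assumes "compact K" "continuous_on K f"
  obtains p where "uniform_limit K (\<lambda>n. poly (p n)) f sequentially"
proof -
  have "\<exists>p. \<forall>x\<in>K. \<bar>f x - poly p x\<bar> < inverse (real (Suc n))" for n
  proof -
    obtain g where g: "real_polynomial_function g" "\<And>x. x \<in> K \<Longrightarrow> \<bar>f x - g x\<bar> < inverse (real (Suc n))"
      using Stone_Weierstrass_real_polynomial_function[OF assms, of "inverse (real (Suc n))"] by auto
    from g(1) obtain a m where "g = (\<lambda>x. \<Sum>i\<le>m. a i * x ^ i)"
      unfolding real_polynomial_function_iff_sum by blast
    then have "g = poly (\<Sum>i\<le>m. monom (a i) i)" by (simp add: poly_sum poly_monom fun_eq_iff)
    then show ?thesis using g(2) by blast
  qed
  then obtain p where p: "\<And>n x. x \<in> K \<Longrightarrow> \<bar>f x - poly (p n) x\<bar> < inverse (real (Suc n))"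
    by metis
  have "uniform_limit K (\<lambda>n. poly (p n)) f sequentially"
  proof (rule uniform_limitI)
    fix e :: real assume "e > 0"
    with LIMSEQ_inverse_real_of_nat have "\<forall>\<^sub>F n in sequentially. inverse (real (Suc n)) < e"
      by (rule order_tendstoD)
    then show "\<forall>\<^sub>F n in sequentially. \<forall>x\<in>K. dist (poly (p n) x) (f x) < e"
      by eventually_elim (auto simp: dist_real_def abs_minus_commute intro: less_trans[OF p])
  qed
  then show ?thesis using that by blast
qed

text \<open>The first assumption provides an actual approximating sequence; otherwise every
  \<open>T\<close> would satisfy the defining condition vacuously and uniqueness would fail.\<close>

lemma fun_calc_eqI:
  assumes "uniform_limit (real_spectrum A) (\<lambda>n. poly (q n)) f sequentially"
    and "\<And>p. uniform_limit (real_spectrum A) (\<lambda>n. poly (p n)) f sequentially \<Longrightarrow>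
      (\<lambda>n. op_poly (p n) A) \<longlonglongrightarrow> T"
  shows "fun_calc f A = T"
  unfolding fun_calc_def using assms by (intro the_equality) (auto intro: LIMSEQ_unique)

lemma fun_calc_sqrt:
  fixes C :: "'a::complex_hilbert_space op"
  assumes nonzero: "\<exists>x::'a. x \<noteq> 0" and C: "C \<in> BH_pd" and f: "\<And>x. x > 0 \<Longrightarrow> f x = sqrt x"
  shows "fun_calc f C = op_sqrt C"
proof -
  obtain c where c: "c > 0" "real_spectrum C \<subseteq> {c..norm C}"
    using real_spectrum_BH_pd[OF C] .
  have cong: "uniform_limit (real_spectrum C) (\<lambda>n. poly (p n)) f sequentially \<longleftrightarrow>
      uniform_limit (real_spectrum C) (\<lambda>n. poly (p n)) sqrt sequentially" for p
    using c f by (intro uniform_limit_cong') auto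
  \<comment> \<open>The approximation is made on the enclosing interval, which is visibly compact,
    and then restricted to the spectrum.\<close>
  obtain q where q: "uniform_limit {c..norm C} (\<lambda>n. poly (q n)) sqrt sequentially"
    by (rule poly_uniform_approximation[of "{c..norm C}" sqrt]) (auto intro: continuous_intros)
  show ?thesis
  proof (rule fun_calc_eqI)
    show "uniform_limit (real_spectrum C) (\<lambda>n. poly (q n)) f sequentially"
      unfolding cong using q c(2) by (rule uniform_limit_on_subset)
    show "(\<lambda>n. op_poly (p n) C) \<longlonglongrightarrow> op_sqrt C"
      if "uniform_limit (real_spectrum C) (\<lambda>n. poly (p n)) f sequentially" for p
      using op_poly_tendsto_sqrt[OF nonzero op_sqrt_BH_pd(1)[OF C], of p] that
      unfolding op_sqrt_BH_pd(2)[OF C] cong by blast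
  qed
qed

text \<open>On a nonzero space the spectrum is the single point \<open>x\<close>, so uniform
  approximation on it is convergence at \<open>x\<close>.\<close>

lemma fun_calc_scalar:
  assumes nonzero: "\<exists>x::'a::complex_hilbert_space. x \<noteq> 0"
  shows "fun_calc f (x *\<^sub>R id_blinfun :: 'a op) = f x *\<^sub>R id_blinfun"
proof -
  have "\<not> op_invertible (0 :: 'a op)"
  proof
    assume "op_invertible (0 :: 'a op)"
    then obtain B :: "'a op" where "0 o\<^sub>L B = id_blinfun" by (auto simp: op_invertible_def)
    from blinfun_compose_eq_idD[OF this] nonzero show False by auto
  qed
  moreover have "op_invertible ((x *\<^sub>R id_blinfun :: 'a op) - t *\<^sub>R id_blinfun)" if "t \<noteq> x" for t
    using op_invertible_scaleR[OF op_invertible_id, of "x - t"] that by (simp add: scaleR_diff_left)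
  ultimately have spec: "real_spectrum (x *\<^sub>R id_blinfun :: 'a op) = {x}"
    by (auto simp: real_spectrum_def)
  have poly: "op_poly p (x *\<^sub>R id_blinfun :: 'a op) = poly p x *\<^sub>R id_blinfun" for p
    by (induction p) (auto intro!: blinfun_eqI simp: op_poly_pCons blinfun.bilinear_simps scaleR_add_left)
  show ?thesis
  proof (rule fun_calc_eqI)
    show "uniform_limit (real_spectrum (x *\<^sub>R id_blinfun :: 'a op)) (\<lambda>n. poly [:f x:]) f sequentially"
      by (rule uniform_limitI) (simp add: spec)
    fix p assume "uniform_limit (real_spectrum (x *\<^sub>R id_blinfun :: 'a op)) (\<lambda>n. poly (p n)) f sequentially"
    then have "(\<lambda>n. poly (p n) x) \<longlonglongrightarrow> f x"
      by (rule tendsto_uniform_limitI) (simp add: spec)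
    then show "(\<lambda>n. op_poly (p n) (x *\<^sub>R id_blinfun :: 'a op)) \<longlonglongrightarrow> f x *\<^sub>R id_blinfun"
      unfolding poly by (intro tendsto_intros)
  qed
qed

section \<open>Comparison with the geometric mean\<close>

text \<open>\<open>extend_mono\<close> sees an operation only through its values on
  \<open>BH_pd\<close>. Agreement there turns the two definite descriptions into the same condition,
  hence the extensions agree everywhere.\<close>

lemma connection_of_eq_geometric_mean:
  fixes f :: "real \<Rightarrow> real"
  assumes nonzero: "\<exists>x::'a::complex_hilbert_space. x \<noteq> 0" and f: "\<And>x. x > 0 \<Longrightarrow> f x = sqrt x"
  shows "connection_of f = (geometric_mean :: 'a op \<Rightarrow> 'a op \<Rightarrow> 'a op)"
proof -
  define m :: "'a op \<Rightarrow> 'a op \<Rightarrow> 'a op" where "m = (\<lambda>A B.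
    op_sqrt A o\<^sub>L fun_calc f (op_inv (op_sqrt A) o\<^sub>L B o\<^sub>L op_inv (op_sqrt A)) o\<^sub>L op_sqrt A)"
  define g :: "'a op \<Rightarrow> 'a op \<Rightarrow> 'a op" where "g = (\<lambda>A B.
    op_sqrt A o\<^sub>L op_sqrt (op_inv (op_sqrt A) o\<^sub>L B o\<^sub>L op_inv (op_sqrt A)) o\<^sub>L op_sqrt A)"
  have mg: "m A B = g A B" if "A \<in> BH_pd" "B \<in> BH_pd" for A B
    using fun_calc_sqrt[OF nonzero BH_pd_congruence_op_inv[OF op_sqrt_BH_pd(1)] f] that
    by (simp add: m_def g_def)
  have seq: "(\<lambda>n. m (X n) (Y n)) = (\<lambda>n. g (X n) (Y n))"
    if "range X \<subseteq> BH_pd" "range Y \<subseteq> BH_pd" for X Y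
    using that by (intro ext mg) auto
  have "extend_mono m A B = extend_mono g A B" for A B
  proof -
    have "(range X \<subseteq> BH_pd \<longrightarrow> range Y \<subseteq> BH_pd \<longrightarrow> X \<down> A \<longrightarrow> Y \<down> B \<longrightarrow> (\<lambda>n. m (X n) (Y n)) \<down> T) \<longleftrightarrow>
      (range X \<subseteq> BH_pd \<longrightarrow> range Y \<subseteq> BH_pd \<longrightarrow> X \<down> A \<longrightarrow> Y \<down> B \<longrightarrow> (\<lambda>n. g (X n) (Y n)) \<down> T)" for X Y T
      using seq[of X Y] by auto
    then show ?thesis unfolding extend_mono_def by (simp only: mg cong: if_cong conj_cong)
  qed
  then show ?thesis
    unfolding connection_of_def geometric_mean_def by (simp add: m_def g_def fun_eq_iff)
qed

lemma op_sqrt_id: "op_sqrt (id_blinfun :: 'a::complex_hilbert_space op) = id_blinfun"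
  by (rule op_sqrt_eqI) (auto intro!: blinfun_eqI simp: id_BH_pd BH_pd_subset_pos)

lemma op_inv_id: "op_inv (id_blinfun :: 'a::complex_hilbert_space op) = id_blinfun"
  by (rule op_inv_eqI) (auto intro!: blinfun_eqI)

text \<open>Recovers \<open>f\<close> from its connection; both arguments are invertible, so the
  explicit formula applies.\<close>

lemma connection_of_scalar:
  assumes "\<exists>x::'a::complex_hilbert_space. x \<noteq> 0" "x > 0"
  shows "connection_of f id_blinfun (x *\<^sub>R id_blinfun :: 'a op) = f x *\<^sub>R id_blinfun"
proof -
  have [simp]: "id_blinfun o\<^sub>L A o\<^sub>L id_blinfun = A" for A :: "'a op"
    by (rule blinfun_eqI) simp
  show ?thesis
    using assms by (simp add: connection_of_def extend_mono_def id_BH_pd BH_pd_scaleR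
        op_sqrt_id op_inv_id fun_calc_scalar)
qed

section \<open>The representing function\<close>

lemma periodic_add_of_int:
  fixes g :: "real \<Rightarrow> 'b"
  assumes "\<And>s. g (s + a) = g s"
  shows "g (s + of_int k * a) = g s"
proof (induction k rule: int_induct[where k = 0])
  case (step1 i)
  then show ?case using assms[of "s + of_int i * a"] by (simp add: algebra_simps)
next
  case (step2 i)
  then show ?case using assms[of "s + of_int (i - 1) * a"] by (simp add: algebra_simps)
qed simp

text \<open>Integer combinations of incommensurable periods are dense, so \<open>g\<close> takes the
  value \<open>g 0\<close> on a dense set.\<close>

lemma continuous_incommensurable_periods_constant:
  fixes g :: "real \<Rightarrow> real"
  assumes cont: "continuous_on UNIV g"
    and a: "\<And>s. g (s + a) = g s" and b: "\<And>s. g (s + b) = g s"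
    and irrational: "a / b \<notin> \<rat>"
  shows "g s = g 0"
proof -
  have "b \<noteq> 0" using irrational by auto
  \<comment> \<open>After rescaling by \<open>b\<close> the periods become \<open>a / b\<close> and
    1, the setting of Kronecker's density theorem.\<close>
  have "\<exists>t. \<bar>t - s / b\<bar> < inverse (real (Suc n)) \<and> g (b * t) = g 0" for n
  proof -
    obtain h k where "k > 0" and hk: "\<bar>of_int k * (a / b) - of_int h - s / b\<bar> < inverse (real (Suc n))"
      by (rule sequence_of_fractional_parts_is_dense[OF irrational, of "inverse (real (Suc n))" "s / b"])
        auto
    have "b * (of_int k * (a / b) - of_int h) = 0 + of_int k * a + of_int (- h) * b"
      using \<open>b \<noteq> 0\<close> by (simp add: field_simps)
    then have "g (b * (of_int k * (a / b) - of_int h)) = g 0"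
      using periodic_add_of_int[of g, OF a] periodic_add_of_int[of g, OF b] by metis
    with hk show ?thesis by blast
  qed
  then obtain t where t: "\<And>n. \<bar>t n - s / b\<bar> < inverse (real (Suc n))" "\<And>n. g (b * t n) = g 0"
    by metis
  have "(\<lambda>n. t n - s / b) \<longlonglongrightarrow> 0"
    by (rule Lim_null_comparison[OF _ LIMSEQ_inverse_real_of_nat])
      (use t(1) in \<open>auto intro!: always_eventually less_imp_le\<close>)
  then have "(\<lambda>n. b * t n) \<longlonglongrightarrow> b * (s / b)"
    by (intro tendsto_intros) (simp add: LIM_zero_iff)
  then have "(\<lambda>n. b * t n) \<longlonglongrightarrow> s" using \<open>b \<noteq> 0\<close> by simp
  then have "(\<lambda>n. g (b * t n)) \<longlonglongrightarrow> g s"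
    using cont by (intro isCont_tendsto_compose[of s g]) (auto simp: continuous_on_eq_continuous_at)
  then show ?thesis by (simp add: t(2) LIMSEQ_const_iff)
qed

text \<open>Condition (i) enters the converse direction through this continuity, inherited from the
  analytic extension.\<close>

lemma in_OM_plus_continuous_on:
  assumes "in_OM_plus f"
  shows "continuous_on {0<..} f"
proof -
  obtain F where F: "F analytic_on (- \<real>\<^sub>\<le>\<^sub>0)" "\<And>x. x > 0 \<Longrightarrow> F (of_real x) = of_real (f x)"
    using assms by (auto simp: in_OM_plus_def OM_plus_def)
  have "continuous_on (- \<real>\<^sub>\<le>\<^sub>0) F"
    using F(1) by (intro holomorphic_on_imp_continuous_on analytic_imp_holomorphic)
  then have "continuous_on {0<..} (\<lambda>x. F (of_real x))"
    by (rule continuous_on_compose2) (auto intro!: continuous_intros simp: complex_nonpos_Reals_iff)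
  then have "continuous_on {0<..} (\<lambda>x. Re (F (of_real x)))"
    by (rule continuous_on_Re)
  then show ?thesis by (rule continuous_on_eq) (simp add: F(2))
qed

lemma sqrt_characterization:
  assumes cont: "continuous_on {0<..} f" and f1: "f 1 = 1"
    and c: "c1 > 0" "c2 > 0" and irrational: "ln c1 / ln c2 \<notin> \<rat>"
    and scale: "\<And>x. x > 0 \<Longrightarrow> f (c1\<^sup>2 * x) = c1 * f x" "\<And>x. x > 0 \<Longrightarrow> f (c2\<^sup>2 * x) = c2 * f x"
    and x: "x > 0"
  shows "f x = sqrt x"
proof -
  define g where "g s = f (exp s) / exp (s / 2)" for s
  have period: "g (s + 2 * ln c) = g s"
    if "c > 0" "\<And>x. x > 0 \<Longrightarrow> f (c\<^sup>2 * x) = c * f x" for c s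
  proof -
    have "exp (2 * ln c) = c\<^sup>2" using that(1) by (simp add: exp_double)
    then have "exp (s + 2 * ln c) = c\<^sup>2 * exp s" by (simp add: exp_add mult.commute)
    moreover have "exp ((s + 2 * ln c) / 2) = c * exp (s / 2)"
      using that(1) by (simp add: add_divide_distrib exp_add)
    ultimately show ?thesis using that by (simp add: g_def)
  qed
  have "g (ln x) = g 0"
  proof (rule continuous_incommensurable_periods_constant)
    have "continuous_on UNIV (\<lambda>s. f (exp s))"
      by (rule continuous_on_compose2[OF cont]) (auto intro!: continuous_intros)
    then show "continuous_on UNIV g"
      unfolding g_def by (rule continuous_on_divide) (auto intro!: continuous_intros)
    show "g (s + 2 * ln c1) = g s" "g (s + 2 * ln c2) = g s" for s
      using period c scale by blast+
    show "2 * ln c1 / (2 * ln c2) \<notin> \<rat>" using irrational by simp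
  qed
  then have "f x = exp (ln x / 2)" using x f1 by (simp add: g_def)
  also have "\<dots> = sqrt x"
    using x by (intro real_sqrt_unique[symmetric]) (simp_all add: exp_double[symmetric])
  finally show ?thesis .
qed

lemma in_OM_plus_sqrt:
  assumes "\<And>x. x > 0 \<Longrightarrow> f x = sqrt x"
  shows "in_OM_plus f"
  unfolding in_OM_plus_def OM_plus_def
proof (intro bexI[of _ csqrt] CollectI conjI allI impI)
  show "csqrt analytic_on (- \<real>\<^sub>\<le>\<^sub>0)"
    by (intro analytic_intros) (auto simp: complex_nonpos_Reals_iff)
  fix z assume "Im z > 0"
  \<comment> \<open>For the principal branch, \<open>Im (csqrt z)\<close> is
    \<open>sqrt ((cmod z - Re z) / 2)\<close> with the sign of \<open>Im z\<close>.\<close>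
  then show "0 \<le> Im (csqrt z)" using csqrt_principal[of z] by (auto simp: complex_Re_le_cmod)
qed (use assms in auto)

text \<open>Countability of the rationals gives an irrational \<open>r\<close>, and
  \<open>exp r\<close>, \<open>exp 1\<close> have logarithms \<open>r\<close> and 1.\<close>

lemma exists_log_incommensurable:
  "\<exists>c1 c2 :: real. c1 > 0 \<and> c2 > 0 \<and> c1 \<noteq> 1 \<and> c2 \<noteq> 1 \<and> ln c1 / ln c2 \<notin> \<rat>"
proof -
  have "(UNIV :: real set) \<noteq> \<rat>"
    using countable_rat[where 'a = real] uncountable_UNIV_real by auto
  then obtain r :: real where "r \<notin> \<rat>" by auto
  moreover then have "r \<noteq> 0" by auto
  ultimately show ?thesis by (intro exI[of _ "exp r"] exI[of _ "exp 1"]) auto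
qed

theorem theorem20:
  fixes \<sigma> :: "'a::complex_hilbert_space op \<Rightarrow> 'a op \<Rightarrow> 'a op"
    and f :: "real \<Rightarrow> real"
  assumes nonzero: "\<exists>x::'a. x \<noteq> 0"
    and connection: "is_connection \<sigma>"
    and representing: "eq_on_pos \<sigma> (connection_of f)"
  shows "eq_on_pos \<sigma> geometric_mean \<longleftrightarrow>
    in_OM_plus f \<and>
    f 1 = 1 \<and>
    (\<forall>x>0. x * f (1 / x) = f x) \<and>
    (\<exists>c1 c2. c1 > 0 \<and> c2 > 0 \<and> c1 \<noteq> 1 \<and> c2 \<noteq> 1 \<and> ln c1 / ln c2 \<notin> \<rat> \<and>
       (\<forall>x>0. f (c1\<^sup>2 * x) = c1 * f x) \<and> (\<forall>x>0. f (c2\<^sup>2 * x) = c2 * f x))"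
    (is "_ \<longleftrightarrow> ?char")
proof
  assume geo: "eq_on_pos \<sigma> geometric_mean"
  have f: "f x = sqrt x" if "x > 0" for x
  proof -
    have "x *\<^sub>R id_blinfun \<in> (BH_pd :: 'a op set)" "id_blinfun \<in> (BH_pd :: 'a op set)"
      using that by (auto intro: BH_pd_scaleR id_BH_pd)
    then have "connection_of f id_blinfun (x *\<^sub>R id_blinfun :: 'a op) = geometric_mean id_blinfun (x *\<^sub>R id_blinfun)"
      using geo representing BH_pd_subset_pos unfolding eq_on_pos_def by metis
    \<comment> \<open>Seen as the connection of \<open>sqrt\<close>, the geometric mean can be
      evaluated at scalars by the same formula.\<close>
    also have "geometric_mean = (connection_of sqrt :: 'a op \<Rightarrow> 'a op \<Rightarrow> 'a op)"
      using connection_of_eq_geometric_mean[OF nonzero, of sqrt] by simp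
    finally have "f x *\<^sub>R (id_blinfun :: 'a op) = sqrt x *\<^sub>R id_blinfun"
      using connection_of_scalar[OF nonzero that] by metis
    moreover obtain y :: 'a where "y \<noteq> 0" using nonzero by auto
    ultimately have "f x *\<^sub>R y = sqrt x *\<^sub>R y"
      by (metis blinfun.scaleR_left blinfun_apply_id_blinfun)
    with \<open>y \<noteq> 0\<close> show ?thesis by simp
  qed
  show ?char
  proof (intro conjI)
    show "in_OM_plus f" using f by (rule in_OM_plus_sqrt)
    show "f 1 = 1" by (simp add: f)
    show "\<forall>x>0. x * f (1 / x) = f x" by (simp add: f real_sqrt_divide real_div_sqrt)
    \<comment> \<open>The square root obeys the scaling relation for every positive
      \<open>c\<close>, so any incommensurable pair is a witness.\<close>
    have "f (c\<^sup>2 * x) = c * f x" if "c > 0" "x > 0" for c x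
      using that by (simp add: f real_sqrt_mult)
    then show "\<exists>c1 c2. c1 > 0 \<and> c2 > 0 \<and> c1 \<noteq> 1 \<and> c2 \<noteq> 1 \<and> ln c1 / ln c2 \<notin> \<rat> \<and>
       (\<forall>x>0. f (c1\<^sup>2 * x) = c1 * f x) \<and> (\<forall>x>0. f (c2\<^sup>2 * x) = c2 * f x)"
      using exists_log_incommensurable by blast
  qed
next
  assume char: ?char
  then obtain c1 c2 where "c1 > 0" "c2 > 0" "ln c1 / ln c2 \<notin> \<rat>"
    and "\<And>x. x > 0 \<Longrightarrow> f (c1\<^sup>2 * x) = c1 * f x" "\<And>x. x > 0 \<Longrightarrow> f (c2\<^sup>2 * x) = c2 * f x"
    by blast
  with char have "f x = sqrt x" if "x > 0" for x
    using that by (intro sqrt_characterization[of f c1 c2] in_OM_plus_continuous_on) auto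
  then have "connection_of f = (geometric_mean :: 'a op \<Rightarrow> 'a op \<Rightarrow> 'a op)"
    by (rule connection_of_eq_geometric_mean[OF nonzero])
  with representing show "eq_on_pos \<sigma> geometric_mean" by simp
qed

end
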